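(* Let $\Psi\in\mathcal L$ and let $\lambda$ be a Borel function with period $\kappa>0$ and $0\le\lambda(t)\le\lambda_h\in(0,\infty)$ for all $t$. Assume $\rho_h=\lambda_h\int_0^\infty y\,dG(y)<1$. Let $\varphi$ be the length of a busy period (started by the arrival of a single customer with service time distributed according to $G$ to an empty system) in a FCFS $M/G/1$ queue (no balking) with arrival rate $\lambda_h$ and service cdf $G$. If $G$ is subexponential and $$\lim_{u\to\infty}\frac{P(\varphi>u)}{1-G(u(1-\rho_h))}=(1-\rho_h)^{-1},$$ then $$\limsup_{u\to\infty}\frac{P(\xi_\lambda>u)}{1-G\big([u-\max\{\kappa,1\}](1-\rho_h)\big)}\le\frac{1-e^{-\kappa\lambda_h}}{(1-\rho_h)e^{-\kappa\lambda_h}}.$$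
   Context: $\mathcal L$ is the set of all bivariate cdfs with support in $(0,\infty)\times(0,\infty]$. For $\Psi\in\mathcal L$, $G(s)=\Psi(s,\infty)$ is the service-time cdf. The $M_t/G(\Psi)/1+H(\Psi)$ queue is defined as follows. - It is a single-server FCFS queue with infinite waiting room, started empty at time $0$. - Arrivals form an inhomogeneous Poisson process with rate $\lambda(\cdot)$. - $(S_i,Y_i)$ are iid with cdf $\Psi$ and independent of the arrivals. - The $i$-th arrival at time $T_i$ joins if and only if $Y_i\ge W_\lambda(T_i-)$, where $W_\lambda$ is the workload process (decreasing at unit rate while positive), and if he joins the workload jumps by $S_i$. Define $\xi_\lambda=\inf\{\kappa n:n\in\mathbb N,\ W_\lambda(\kappa n)=0\}$ (the first multiple of the period at which the system is empty). *)

theory Defs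
  imports "HOL-Probability.Probability"
begin

definition in_L :: "(real \<Rightarrow> ereal \<Rightarrow> real) \<Rightarrow> bool" where
  "in_L \<Psi> \<longleftrightarrow> (\<exists>Q :: (real \<times> ereal) measure.
      prob_space Q \<and> sets Q = sets borel \<and>
      measure Q ({0<..} \<times> {0<..}) = 1 \<and>
      (\<forall>s y. \<Psi> s y = measure Q ({..s} \<times> {..y})))"

definition svc_cdf :: "(real \<Rightarrow> ereal \<Rightarrow> real) \<Rightarrow> real \<Rightarrow> real" where
  "svc_cdf \<Psi> s = \<Psi> s \<infinity>"

definition subexponential :: "(real \<Rightarrow> real) \<Rightarrow> bool" where
  "subexponential G \<longleftrightarrow> (\<forall>x. G x < 1) \<and>
     ((\<lambda>x. (1 - (\<integral>y. G (x - y) \<partial>interval_measure G)) / (1 - G x)) \<longlongrightarrow> 2) at_top"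

text \<open>N w t = number of arrivals in (0,t]. Paths: start at 0, nondecreasing,
  right-continuous, unit jumps; independent increments; Poisson-distributed
  increments with mean equal to the integral of the rate.\<close>
definition poisson_process :: "'a measure \<Rightarrow> (real \<Rightarrow> real) \<Rightarrow> ('a \<Rightarrow> real \<Rightarrow> nat) \<Rightarrow> bool" where
  "poisson_process M lam N \<longleftrightarrow>
     prob_space M \<and>
     (\<forall>t. (\<lambda>w. N w t) \<in> measurable M (count_space UNIV)) \<and>
     (\<forall>w\<in>space M. N w 0 = 0 \<and> mono_on {0..} (N w) \<and>
        (\<forall>t\<ge>0. \<exists>d>0. \<forall>s\<in>{t..t+d}. N w s = N w t) \<and>
        (\<forall>t>0. \<exists>d>0. \<forall>s\<in>{t-d<..<t}. N w t \<le> Suc (N w s))) \<and>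
     (\<forall>(n::nat) (ts :: nat \<Rightarrow> real). 0 \<le> ts 0 \<and> (\<forall>i<n. ts i \<le> ts (Suc i)) \<longrightarrow>
        prob_space.indep_vars M (\<lambda>_. count_space UNIV)
          (\<lambda>i w. N w (ts (Suc i)) - N w (ts i)) {..<n}) \<and>
     (\<forall>a b k. 0 \<le> a \<and> a \<le> b \<longrightarrow>
        measure M {w\<in>space M. N w b - N w a = k} =
          (\<integral>t\<in>{a..b}. lam t \<partial>lborel) ^ k / fact k * exp (- (\<integral>t\<in>{a..b}. lam t \<partial>lborel)))"

definition arr_time :: "(real \<Rightarrow> nat) \<Rightarrow> nat \<Rightarrow> real" where
  "arr_time n k = (if k = 0 then 0 else Inf {t. 0 \<le> t \<and> k \<le> n t})"

text \<open>Workload right after the k-th arrival epoch (k-th arrival uses mark k),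
  starting from workload w0 at time 0. The k-th arrival joins iff
  Y_k \<ge> W(T_k-), and then the workload jumps by S_k.\<close>
fun wl_after :: "(nat \<Rightarrow> real) \<Rightarrow> real \<Rightarrow> (nat \<Rightarrow> real) \<Rightarrow> (nat \<Rightarrow> ereal) \<Rightarrow> nat \<Rightarrow> real" where
  "wl_after T w0 S Y 0 = w0"
| "wl_after T w0 S Y (Suc k) =
     (let v = max (wl_after T w0 S Y k - (T (Suc k) - T k)) 0
      in if ereal v \<le> Y (Suc k) then v + S (Suc k) else v)"

definition workload :: "(real \<Rightarrow> nat) \<Rightarrow> real \<Rightarrow> (nat \<Rightarrow> real) \<Rightarrow> (nat \<Rightarrow> ereal) \<Rightarrow> real \<Rightarrow> real" where
  "workload n w0 S Y t =
     max (wl_after (arr_time n) w0 S Y (n t) - (t - arr_time n (n t))) 0"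

text \<open>xi = inf { kappa*n : n \<ge> 1, W(kappa*n) = 0 } (inf of empty set = oo).\<close>
definition xi_time :: "real \<Rightarrow> (real \<Rightarrow> real) \<Rightarrow> ereal" where
  "xi_time \<kappa> W = Inf {ereal (\<kappa> * real n) | n. 1 \<le> n \<and> W (\<kappa> * real n) = 0}"

definition busy_period :: "(real \<Rightarrow> real) \<Rightarrow> ereal" where
  "busy_period W = Inf {ereal t | t. 0 < t \<and> W t = 0}"

end

(* Time is cut into slots of length kappa/K. On the event that no slot contains two arrivals, the
   workload at the slot boundaries is dominated by a Lindley chain with at most one service per slot,
   and by monotonicity the arrival probability per slot may be raised to 1 - exp(-lamh*kappa/K). From an
   idle slot, this chain misses the next multiple of kappa only if a customer arrives before it, which
   has probability at most beta = 1 - exp(-kappa*lamh); then it loses at most kappa plus a busy period.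
   Hence every nonincreasing D with D = 1 on the negative axis and D(u) >= beta * E D(u - (phi + kappa + 1))
   for u >= 0 dominates P(xi > u), up to a shift of u and an error that vanishes as K grows.

   Let Q(u) = 1 - G(u(1 - rho)). Subexponentiality makes min(1, A Q) such a supersolution for large A.
   Replacing D by beta * E D(u - (phi + kappa + 1)) turns an asymptotic constant l into beta * (c0 + l),
   where c0 = 1/(1 - rho), so the infimum of the attainable constants is at most beta * c0/(1 - beta). *)

theory Submission
  imports Defs
begin

section \<open>A chain in slotted time\<close>

text \<open>The obstacle is the renewal step at the end of a busy period: in continuous time it
  calls for a strong Markov property, while the arrivals are given only by their paths and
  independent Poisson increments. On a grid, finitely many cell counts and the marks suffice, and
  the renewal step becomes an induction on the number of remaining slots. For fixed u the grid
  errors are O(1/K): each of the O(K) cells holds two arrivals with probability O(1/K^2), and an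
  arrival in the last cell before a multiple of kappa has probability O(1/K).

  The true busy period enters only through its tail, in the opposite direction: the slotted busy
  chain must not outlive it, up to such an error.

  The constant reflects a single big jump: failed attempts are dominated by a geometric number with
  mean beta/(1 - beta), and each has a tail equivalent to c0 * Q. Summing over attempts would
  require a uniform bound on convolution powers; the a priori supersolution takes its place. Bounded
  shifts of u are harmless because Q is long-tailed.\<close>

lemma borel_measurable_antimono:
  fixes f :: "real \<Rightarrow> real"
  assumes "antimono f"
  shows "f \<in> borel_measurable borel"
proof -
  have "(\<lambda>x. - f x) \<in> borel_measurable borel"
    using assms by (intro borel_measurable_mono) (auto simp: monotone_def)
  then show ?thesis by simp
qed

text \<open>The state \<open>x\<close> is the workload minus \<open>h\<close>: the coming slot is
  paid in advance, so \<open>0 < x\<close> means that the server cannot run empty within it, and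
  \<open>g x\<close> is what is left at its end before a new service is added. \<open>g\<close> is
  the positive part if the server may idle, and the identity if the chain is killed on leaving the
  positive axis.\<close>

fun survives :: "(nat \<Rightarrow> real \<Rightarrow> bool) \<Rightarrow> (real \<Rightarrow> real) \<Rightarrow> real \<Rightarrow> bool list \<Rightarrow> real \<Rightarrow> (nat \<Rightarrow> real) \<Rightarrow> bool" where
  "survives P g h [] x \<omega> \<longleftrightarrow> P 0 x"
| "survives P g h (c # cs) x \<omega> \<longleftrightarrow> P (Suc (length cs)) x \<and>
     survives P g h cs (g x + (if c then \<omega> 0 else 0) - h) (if c then \<lambda>i. \<omega> (Suc i) else \<omega>)"

text \<open>Only subprobabilities: the missing mass is that of slots with two or more arrivals,
  which no pattern records.\<close>

definition weights :: "(nat \<Rightarrow> bool \<Rightarrow> real) \<Rightarrow> bool" where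
  "weights w \<longleftrightarrow> (\<forall>i. 0 \<le> w i False \<and> 0 \<le> w i True \<and> w i False + w i True \<le> 1)"

lemma weights_Suc: "weights w \<Longrightarrow> weights (\<lambda>i. w (Suc i))"
  by (simp add: weights_def)

lemma sum_lists_Suc:
  fixes F :: "'a::finite list \<Rightarrow> 'b::comm_monoid_add"
  shows "(\<Sum>cs | length cs = Suc n. F cs) = (\<Sum>c\<in>UNIV. \<Sum>cs | length cs = n. F (c # cs))"
proof -
  have "(\<Sum>cs | length cs = Suc n. F cs) = (\<Sum>(c, cs)\<in>UNIV \<times> {cs. length cs = n}. F (c # cs))"
    by (rule sum.reindex_bij_witness[of _ "\<lambda>(c, cs). c # cs" "\<lambda>cs. (hd cs, tl cs)"])
       (auto simp: length_Suc_conv)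
  then show ?thesis by (simp add: sum.cartesian_product)
qed

lemma finite_lists_length: "finite {cs :: 'a::finite list. length cs = n}"
  using finite_lists_length_eq[of "UNIV :: 'a set" n] by simp

text \<open>Time is cut into slots of length \<open>h\<close>. The list tells which of the remaining slots contain an
  arrival, and \<open>\<omega>\<close> supplies the service times in order of arrival. \<open>P n x\<close> is the condition under
  which the chain stays alive in state \<open>x\<close> with \<open>n\<close> slots to go: counting down lets the value
  \<open>val\<close> below satisfy a backward recursion.\<close>

locale slotted_chain = real_distribution \<mu> for \<mu> :: "real measure" +
  fixes P :: "nat \<Rightarrow> real \<Rightarrow> bool" and g :: "real \<Rightarrow> real" and h :: real
  assumes P_mono: "P n x \<Longrightarrow> x \<le> y \<Longrightarrow> P n y"
    and g_mono: "x \<le> y \<Longrightarrow> g x \<le> g y"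
    and AE_pos: "AE s in \<mu>. 0 \<le> s"
begin

abbreviation "marks \<equiv> Pi\<^sub>M (UNIV :: nat set) (\<lambda>_. \<mu>)"

sublocale seq: sequence_space \<mu> ..

primrec val :: "nat \<Rightarrow> (nat \<Rightarrow> bool \<Rightarrow> real) \<Rightarrow> real \<Rightarrow> real" where
  "val 0 w x = of_bool (P 0 x)"
| "val (Suc n) w x = of_bool (P (Suc n) x) * (w 0 False * val n (\<lambda>i. w (Suc i)) (g x - h)
     + w 0 True * (\<integral>s. val n (\<lambda>i. w (Suc i)) (g x + s - h) \<partial>\<mu>))"

lemma g_measurable: "g \<in> borel_measurable borel"
  by (rule borel_measurable_mono) (simp add: mono_def g_mono)

lemma P_measurable: "Measurable.pred borel (P n)"
proof -
  have "(\<lambda>x. of_bool (P n x) :: real) \<in> borel_measurable borel"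
    by (rule borel_measurable_mono) (auto simp: mono_def dest: P_mono)
  then have "Measurable.pred borel (\<lambda>x. of_bool (P n x) = (1::real))" by measurable
  then show ?thesis by simp
qed

lemma val_props:
  assumes "weights w"
  shows "mono (val n w)" "0 \<le> val n w x" "val n w x \<le> 1"
proof -
  have "mono (val n w) \<and> (\<forall>x. 0 \<le> val n w x \<and> val n w x \<le> 1)"
    using assms
  proof (induction n arbitrary: w)
    case 0
    show ?case by (auto simp: mono_def dest: P_mono)
  next
    case (Suc n)
    define v where "v = val n (\<lambda>i. w (Suc i))"
    have v: "mono v" "\<And>x. 0 \<le> v x" "\<And>x. v x \<le> 1"
      using Suc.IH[OF weights_Suc[OF Suc.prems]] by (auto simp: v_def)
    have [measurable]: "v \<in> borel_measurable borel" using v(1) by (rule borel_measurable_mono)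
    have int: "integrable \<mu> (\<lambda>s. v (y + s - h))" for y
      by (rule integrable_const_bound[where B = 1]) (auto simp: v)
    define I where "I = (\<lambda>y. \<integral>s. v (y + s - h) \<partial>\<mu>)"
    have I_mono: "I y \<le> I z" if "y \<le> z" for y z
      unfolding I_def by (intro integral_mono int) (use that v(1) in \<open>auto simp: mono_def\<close>)
    have I0: "0 \<le> I y" for y unfolding I_def by (simp add: v)
    have I1: "I y \<le> 1" for y
      using integral_mono[OF int[of y], of "\<lambda>_. 1"] v(3) by (simp add: I_def prob_space del: space_eq_univ)
    have w: "0 \<le> w 0 False" "0 \<le> w 0 True" "w 0 False + w 0 True \<le> 1"
      using Suc.prems by (auto simp: weights_def)
    define J where "J = (\<lambda>x. w 0 False * v (g x - h) + w 0 True * I (g x))"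
    have J: "J x \<le> J y" if "x \<le> y" for x y
      unfolding J_def using w g_mono[OF that] v(1)
      by (intro add_mono mult_left_mono I_mono) (auto simp: mono_def)
    have J0: "0 \<le> J x" for x unfolding J_def using w v I0 by simp
    have J1: "J x \<le> 1" for x
    proof -
      have "J x \<le> w 0 False * 1 + w 0 True * 1"
        unfolding J_def using w v I1 by (intro add_mono mult_left_mono) auto
      then show ?thesis using w by simp
    qed
    have eq: "val (Suc n) w x = of_bool (P (Suc n) x) * J x" for x
      by (simp add: J_def v_def I_def)
    have "val (Suc n) w x \<le> val (Suc n) w y" if "x \<le> y" for x y
      unfolding eq using J[OF that] J0 P_mono[of "Suc n", OF _ that] by (auto simp: of_bool_def)
    moreover have "0 \<le> val (Suc n) w x \<and> val (Suc n) w x \<le> 1" for x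
      unfolding eq using J0 J1 by (auto simp: of_bool_def)
    ultimately show ?case unfolding mono_def by blast
  qed
  then show "mono (val n w)" "0 \<le> val n w x" "val n w x \<le> 1" by simp_all
qed

lemma val_measurable: "weights w \<Longrightarrow> val n w \<in> borel_measurable borel"
  using val_props(1) by (rule borel_measurable_mono)

lemma val_integrable: "weights w \<Longrightarrow> integrable \<mu> (\<lambda>s. val n w (y + s - h))"
proof -
  assume w: "weights w"
  note [measurable] = val_measurable[OF w]
  show ?thesis
    by (rule integrable_const_bound[where B = 1]) (auto simp: val_props[OF w])
qed

lemma survives_measurable:
  "Measurable.pred (borel \<Otimes>\<^sub>M marks) (\<lambda>(x, \<omega>). survives P g h cs x \<omega>)"
proof (induction cs)
  case Nil
  note [measurable] = P_measurable
  show ?case by simp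
next
  case (Cons c cs)
  note [measurable] = P_measurable g_measurable
  have [measurable]: "(\<lambda>z. snd z i) \<in> borel_measurable (borel \<Otimes>\<^sub>M marks)" for i
    by measurable
  have shift: "(\<lambda>z i. snd z (Suc i)) \<in> measurable (borel \<Otimes>\<^sub>M marks) marks"
    by (rule measurable_PiM_single') (auto simp: space_PiM)
  have [measurable]: "(\<lambda>z. (g (fst z) + (if c then snd z 0 else 0) - h, if c then (\<lambda>i. snd z (Suc i)) else snd z))
     \<in> measurable (borel \<Otimes>\<^sub>M marks) (borel \<Otimes>\<^sub>M marks)"
    using shift by (cases c) (auto intro!: measurable_Pair)
  from Cons measurable_compose[OF this Cons]
  show ?case by (simp add: case_prod_unfold)
qed

lemma survives_add_measurable:
  "Measurable.pred (borel \<Otimes>\<^sub>M marks) (\<lambda>(s, \<omega>). survives P g h cs (x + s - h) \<omega>)"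
proof -
  have "(\<lambda>z. (x + fst z - h, snd z)) \<in> measurable (borel \<Otimes>\<^sub>M marks) (borel \<Otimes>\<^sub>M marks)"
    by measurable
  from measurable_compose[OF this survives_measurable[of cs]] show ?thesis
    by (simp add: case_prod_unfold)
qed

lemma survives_sets: "{\<omega>\<in>space marks. survives P g h cs x \<omega>} \<in> sets marks"
proof -
  note [measurable] = survives_measurable
  show ?thesis by measurable
qed

text \<open>Prepending an independent coordinate with law \<open>\<mu>\<close> leaves the product
  measure invariant (\<open>seq.PiM_iter\<close>); with Fubini this serves as the Markov property of
  the chain at an arrival.\<close>

lemma measure_mark_shift:
  assumes [measurable]: "Measurable.pred (borel \<Otimes>\<^sub>M marks) (\<lambda>(s, \<omega>). Q s \<omega>)"
  shows "{\<omega>\<in>space marks. Q (\<omega> 0) (\<lambda>i. \<omega> (Suc i))} \<in> sets marks"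
    and "measure marks {\<omega>\<in>space marks. Q (\<omega> 0) (\<lambda>i. \<omega> (Suc i))} = (\<integral>s. measure marks {\<omega>\<in>space marks. Q s \<omega>} \<partial>\<mu>)"
proof -
  have [measurable]: "(\<lambda>\<omega> i. \<omega> (Suc i)) \<in> measurable marks marks"
    by (rule measurable_PiM_single') (auto simp: space_PiM)
  show m: "{\<omega>\<in>space marks. Q (\<omega> 0) (\<lambda>i. \<omega> (Suc i))} \<in> sets marks" by measurable
  have [measurable]: "(\<lambda>(s, \<omega>). case_nat s \<omega>) \<in> measurable (\<mu> \<Otimes>\<^sub>M marks) marks" by measurable
  interpret pp: pair_prob_space \<mu> marks ..
  have *: "Measurable.pred (\<mu> \<Otimes>\<^sub>M marks) (\<lambda>(s, \<omega>). Q s \<omega>)"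
    using assms by (simp add: measurable_def space_pair_measure sets_pair_measure)
  have "emeasure marks {\<omega>\<in>space marks. Q (\<omega> 0) (\<lambda>i. \<omega> (Suc i))} =
     emeasure (distr (\<mu> \<Otimes>\<^sub>M marks) marks (\<lambda>(s, \<omega>). case_nat s \<omega>)) {\<omega>\<in>space marks. Q (\<omega> 0) (\<lambda>i. \<omega> (Suc i))}"
    by (simp add: seq.PiM_iter)
  also have "\<dots> = emeasure (\<mu> \<Otimes>\<^sub>M marks) {z\<in>space (\<mu> \<Otimes>\<^sub>M marks). case z of (s, \<omega>) \<Rightarrow> Q s \<omega>}"
    by (subst emeasure_distr[OF _ m], measurable)
       (auto intro!: arg_cong[where f = "emeasure _"] simp: space_pair_measure space_PiM)
  also have "\<dots> = (\<integral>\<^sup>+s. emeasure marks {\<omega>\<in>space marks. Q s \<omega>} \<partial>\<mu>)"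
    using * by (subst seq.P.emeasure_pair_measure_alt)
       (auto intro!: nn_integral_cong arg_cong[where f = "emeasure _"] simp: space_pair_measure pred_def)
  also have "\<dots> = (\<integral>\<^sup>+s. ennreal (measure marks {\<omega>\<in>space marks. Q s \<omega>}) \<partial>\<mu>)"
    by (simp add: seq.P.emeasure_eq_measure)
  finally have e: "emeasure marks {\<omega>\<in>space marks. Q (\<omega> 0) (\<lambda>i. \<omega> (Suc i))}
    = (\<integral>\<^sup>+s. ennreal (measure marks {\<omega>\<in>space marks. Q s \<omega>}) \<partial>\<mu>)" .
  show "measure marks {\<omega>\<in>space marks. Q (\<omega> 0) (\<lambda>i. \<omega> (Suc i))} = (\<integral>s. measure marks {\<omega>\<in>space marks. Q s \<omega>} \<partial>\<mu>)"
    unfolding measure_def[of marks "{\<omega>\<in>space marks. Q (\<omega> 0) (\<lambda>i. \<omega> (Suc i))}"] e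
  proof (rule integral_eq_nn_integral[symmetric])
    show "(\<lambda>s. measure marks {\<omega>\<in>space marks. Q s \<omega>}) \<in> borel_measurable \<mu>"
      using * by measurable
  qed simp
qed

lemma measure_survives_Cons:
  "measure marks {\<omega>\<in>space marks. survives P g h (c # cs) x \<omega>} = of_bool (P (Suc (length cs)) x) *
     (if c then (\<integral>s. measure marks {\<omega>\<in>space marks. survives P g h cs (g x + s - h) \<omega>} \<partial>\<mu>)
      else measure marks {\<omega>\<in>space marks. survives P g h cs (g x - h) \<omega>})"
proof (cases "P (Suc (length cs)) x \<and> c")
  case True
  from measure_mark_shift(2)[OF survives_add_measurable] True show ?thesis by simp
qed auto

text \<open>Conditioning on the first slot turns averages over patterns and marks into a function of
  the state. Comparisons of chains then become inductions on \<open>n\<close> that never mention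
  paths.\<close>

lemma sum_weighted_survives:
  "(\<Sum>cs | length cs = n. (\<Prod>j<n. w j (cs ! j)) * measure marks {\<omega>\<in>space marks. survives P g h cs x \<omega>}) = val n w x"
proof (induction n arbitrary: w x)
  case 0
  show ?case by (simp add: seq.P.prob_space)
next
  case (Suc n)
  let ?m = "\<lambda>cs x. measure marks {\<omega>\<in>space marks. survives P g h cs x \<omega>}"
  let ?v = "\<lambda>x. val n (\<lambda>i. w (Suc i)) x"
  have m: "(\<lambda>s. ?m cs (g x + s - h)) \<in> borel_measurable borel" for cs
  proof -
    note [measurable] = survives_add_measurable
    show ?thesis by measurable
  qed
  have int: "integrable \<mu> (\<lambda>s. ?m cs (g x + s - h))" for cs
    by (rule integrable_const_bound[where B = 1]) (use m in auto)
  have "(\<Sum>cs | length cs = Suc n. (\<Prod>j<Suc n. w j (cs ! j)) * ?m cs x) =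
    (\<Sum>c\<in>UNIV. \<Sum>cs | length cs = n. w 0 c * (\<Prod>j<n. w (Suc j) (cs ! j)) * ?m (c # cs) x)"
    by (simp only: sum_lists_Suc prod.lessThan_Suc_shift nth_Cons_0 nth_Cons_Suc)
  also have "\<dots> = of_bool (P (Suc n) x) * (w 0 False * (\<Sum>cs | length cs = n. (\<Prod>j<n. w (Suc j) (cs ! j)) * ?m cs (g x - h))
     + w 0 True * (\<Sum>cs | length cs = n. (\<Prod>j<n. w (Suc j) (cs ! j)) * (\<integral>s. ?m cs (g x + s - h) \<partial>\<mu>)))"
    unfolding measure_survives_Cons
    by (simp add: UNIV_bool sum_distrib_left algebra_simps)
  also have "(\<Sum>cs | length cs = n. (\<Prod>j<n. w (Suc j) (cs ! j)) * (\<integral>s. ?m cs (g x + s - h) \<partial>\<mu>))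
     = (\<integral>s. (\<Sum>cs | length cs = n. (\<Prod>j<n. w (Suc j) (cs ! j)) * ?m cs (g x + s - h)) \<partial>\<mu>)"
    by (subst Bochner_Integration.integral_sum) (auto intro!: int)
  finally show ?case by (simp only: Suc.IH[of "\<lambda>i. w (Suc i)"] val.simps)
qed

text \<open>A service only pushes the state up and \<open>val\<close> increases with the state, so
  the value with an arrival is at least the value without. Giving the missing mass to "no arrival"
  and then raising the weight of an arrival to \<open>q\<close> can only increase the
  mixture.\<close>

lemma val_le_val:
  assumes w: "weights w" and q: "0 \<le> q" "q \<le> 1" "\<And>i. w i True \<le> q"
  shows "val n w x \<le> val n (\<lambda>_ c. if c then q else 1 - q) x"
  using w q
proof (induction n arbitrary: w x)
  case (Suc n)
  let ?v = "val n (\<lambda>_ c. if c then q else 1 - q)"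
  have wq: "weights (\<lambda>_ c. if c then q else 1 - q)" using q by (simp add: weights_def)
  have IH: "val n (\<lambda>i. w (Suc i)) x \<le> ?v x" for x
    using Suc.IH[OF weights_Suc[OF Suc.prems(1)]] Suc.prems by auto
  have w: "0 \<le> w 0 False" "0 \<le> w 0 True" "w 0 False + w 0 True \<le> 1" "w 0 True \<le> q"
    using Suc.prems by (auto simp: weights_def)
  define a b where "a = ?v (g x - h)" and "b = (\<integral>s. ?v (g x + s - h) \<partial>\<mu>)"
  note ws = weights_Suc[OF Suc.prems(1)]
  have "val n (\<lambda>i. w (Suc i)) (g x - h) \<le> a" by (simp add: a_def IH)
  moreover have "(\<integral>s. val n (\<lambda>i. w (Suc i)) (g x + s - h) \<partial>\<mu>) \<le> b"
    unfolding b_def by (intro integral_mono val_integrable[OF ws] val_integrable[OF wq] IH)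
  ultimately have le: "w 0 False * val n (\<lambda>i. w (Suc i)) (g x - h)
     + w 0 True * (\<integral>s. val n (\<lambda>i. w (Suc i)) (g x + s - h) \<partial>\<mu>) \<le> w 0 False * a + w 0 True * b"
    using w by (intro add_mono mult_left_mono) auto
  have ab: "0 \<le> a" "a \<le> b"
  proof -
    show "0 \<le> a" using val_props(2)[OF wq] by (simp add: a_def)
    have "(\<integral>s. a \<partial>\<mu>) \<le> b" unfolding b_def a_def
    proof (intro integral_mono_AE val_integrable[OF wq])
      show "AE s in \<mu>. ?v (g x - h) \<le> ?v (g x + s - h)"
        using AE_pos by eventually_elim (rule monoD[OF val_props(1)[OF wq]], simp)
    qed simp
    then show "a \<le> b" using prob_space by simp
  qed
  note le
  also have "w 0 False * a + w 0 True * b \<le> (1 - q) * a + q * b"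
  proof -
    have "w 0 False * a \<le> (1 - w 0 True) * a" using w ab by (intro mult_right_mono) auto
    moreover have "w 0 True * (b - a) \<le> q * (b - a)" using w ab by (intro mult_right_mono) auto
    ultimately show ?thesis by (simp add: algebra_simps)
  qed
  finally show ?case by (auto simp: a_def b_def of_bool_def)
qed simp

text \<open>The converse up to an error: values are at most 1, so an arrival weight short of
  \<open>q\<close> by at most \<open>d\<close> loses at most \<open>d\<close> per slot. For a
  constant rate the shortfall is the probability of two or more arrivals.\<close>

lemma val_le_val_add:
  assumes w: "weights w" and q: "0 \<le> q" "q \<le> 1" "\<And>i. w i False = 1 - q" "\<And>i. q - d \<le> w i True" "0 \<le> d"
  shows "val n (\<lambda>_ c. if c then q else 1 - q) x \<le> val n w x + n * d"
  using w q
proof (induction n arbitrary: w x)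
  case (Suc n)
  let ?v = "val n (\<lambda>_ c. if c then q else 1 - q)" and ?u = "val n (\<lambda>i. w (Suc i))"
  have wq: "weights (\<lambda>_ c. if c then q else 1 - q)" using q by (simp add: weights_def)
  have IH: "?v x \<le> ?u x + n * d" for x
    using Suc.IH[OF weights_Suc[OF Suc.prems(1)]] Suc.prems by auto
  have w: "0 \<le> w 0 True" "w 0 False = 1 - q" "q - d \<le> w 0 True"
    using Suc.prems by (auto simp: weights_def)
  define a b where "a = ?u (g x - h)" and "b = (\<integral>s. ?u (g x + s - h) \<partial>\<mu>)"
  note ws = weights_Suc[OF Suc.prems(1)]
  note iu = val_integrable[OF weights_Suc[OF Suc.prems(1)]]
  have b: "b \<le> 1"
  proof -
    have "b \<le> (\<integral>s. 1 \<partial>\<mu>)" unfolding b_def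
      by (intro integral_mono iu) (simp_all add: val_props[OF ws])
    then show ?thesis using prob_space by simp
  qed
  have a': "?v (g x - h) \<le> a + n * d" by (simp add: a_def IH)
  have "(\<integral>s. ?v (g x + s - h) \<partial>\<mu>) \<le> (\<integral>s. ?u (g x + s - h) + n * d \<partial>\<mu>)"
    by (intro integral_mono val_integrable[OF wq] IH Bochner_Integration.integrable_add iu) auto
  also have "\<dots> = b + n * d" using prob_space
    by (subst Bochner_Integration.integral_add) (auto simp: iu b_def)
  finally have b': "(\<integral>s. ?v (g x + s - h) \<partial>\<mu>) \<le> b + n * d" .
  have "(1 - q) * ?v (g x - h) + q * (\<integral>s. ?v (g x + s - h) \<partial>\<mu>) \<le> (1 - q) * (a + n * d) + q * (b + n * d)"
    using a' b' Suc.prems by (intro add_mono mult_left_mono) auto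
  also have "\<dots> = (1 - q) * a + q * b + n * d" by (simp add: algebra_simps)
  also have "q * b \<le> w 0 True * b + d"
  proof -
    have "0 \<le> b" unfolding b_def by (simp add: val_props[OF ws])
    then have "(q - d) * b \<le> w 0 True * b" using w by (intro mult_right_mono) auto
    moreover have "d * b \<le> d" using b Suc.prems by (simp add: mult_left_le)
    ultimately show ?thesis by (simp add: algebra_simps)
  qed
  finally have "(1 - q) * ?v (g x - h) + q * (\<integral>s. ?v (g x + s - h) \<partial>\<mu>) \<le> (1 - q) * a + w 0 True * b + Suc n * d"
    by (simp add: algebra_simps)
  then show ?case using Suc.prems w
    by (simp add: a_def b_def of_bool_def)
qed simp

end

section \<open>Supersolutions with a subexponential tail\<close>

locale subexp_comparison = R: real_distribution \<nu> + Z: real_distribution \<zeta>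
  for \<nu> \<zeta> :: "real measure" +
  fixes Q B :: "real \<Rightarrow> real" and c0 \<beta> :: real
  defines "Q \<equiv> (\<lambda>v. measure \<nu> {v<..})" and "B \<equiv> (\<lambda>v. measure \<zeta> {v<..})"
  assumes R_nonneg: "AE r in \<nu>. 0 \<le> r" and Z_nonneg: "AE z in \<zeta>. 0 \<le> z"
    and Q_pos: "\<And>v. 0 < Q v"
    and subexp: "((\<lambda>u. (\<integral>r. Q (u - r) \<partial>\<nu>) / Q u) \<longlongrightarrow> 2) at_top"
    and tail_ratio: "((\<lambda>u. B u / Q u) \<longlongrightarrow> c0) at_top"
    and \<beta>: "0 \<le> \<beta>" "\<beta> < 1"
begin

lemma Q_antimono: "antimono Q"
  unfolding Q_def by (intro antimonoI R.finite_measure_mono) auto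

lemma B_antimono: "antimono B"
  unfolding B_def by (intro antimonoI Z.finite_measure_mono) auto

lemmas [measurable] = borel_measurable_antimono[OF Q_antimono] borel_measurable_antimono[OF B_antimono]

lemma Q_le_1: "Q v \<le> 1" and B_le_1: "B v \<le> 1" and B_nonneg: "0 \<le> B v"
  by (auto simp: Q_def B_def)

lemma Q_neg: "v < 0 \<Longrightarrow> Q v = 1"
  unfolding Q_def using R_nonneg by (subst R.prob_eq_1) auto

lemma B_neg: "v < 0 \<Longrightarrow> B v = 1"
  unfolding B_def using Z_nonneg by (subst Z.prob_eq_1) auto

lemma c0_nonneg: "0 \<le> c0"
  by (rule tendsto_lowerbound[OF tail_ratio]) (auto intro!: always_eventually simp: B_nonneg Q_pos less_imp_le)

lemma Q_tendsto_0: "(Q \<longlongrightarrow> 0) at_top"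
proof -
  have "Q = (\<lambda>v. 1 - cdf \<nu> v)"
    using R.prob_compl[of "{.._}"] by (simp add: fun_eq_iff Q_def cdf_def Compl_atMost[symmetric] Compl_eq_Diff_UNIV)
  moreover have "((\<lambda>v. 1 - cdf \<nu> v) \<longlongrightarrow> 1 - 1) at_top"
    by (intro tendsto_intros R.cdf_lim_at_top_prob)
  ultimately show ?thesis by simp
qed

section \<open>Convolution bounds for subexponential tails\<close>

lemma integrable_R: "f \<in> borel_measurable borel \<Longrightarrow> (\<And>x. \<bar>f x\<bar> \<le> K) \<Longrightarrow> integrable \<nu> f" for f :: "real \<Rightarrow> real"
  by (rule R.integrable_const_bound[where B = K]) auto

lemma integrable_Z: "f \<in> borel_measurable borel \<Longrightarrow> (\<And>x. \<bar>f x\<bar> \<le> K) \<Longrightarrow> integrable \<zeta> f" for f :: "real \<Rightarrow> real"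
  by (rule Z.integrable_const_bound[where B = K]) auto

lemma integrable_indicators:
  assumes "A \<in> sets borel"
  shows "integrable \<nu> (indicator A :: real \<Rightarrow> real)" "integrable \<zeta> (indicator A :: real \<Rightarrow> real)"
  using assms by (auto intro!: integrable_R[where K = 1] integrable_Z[where K = 1] borel_measurable_indicator)

lemma integrable_Q_R: "integrable \<nu> (\<lambda>r. Q (u - r))"
  by (rule integrable_R[where K = 1]) (auto simp: Q_le_1 Q_pos less_imp_le abs_le_iff intro: order_trans[of _ 0])

lemma integrable_Q_Z: "integrable \<zeta> (\<lambda>r. Q (u - r))"
  by (rule integrable_Z[where K = 1]) (auto simp: Q_le_1 Q_pos less_imp_le abs_le_iff intro: order_trans[of _ 0])

lemma integrable_B_R: "integrable \<nu> (\<lambda>r. B (u - r))"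
  by (rule integrable_R[where K = 1]) (auto simp: B_le_1 B_nonneg abs_le_iff intro: order_trans[of _ 0])

text \<open>Both sides are the probability that the sum of independent variables with laws
  \<open>\<nu>\<close> and \<open>\<zeta>\<close> exceeds \<open>u\<close>, integrated in either
  order.\<close>

lemma convolution_commute: "(\<integral>z. Q (u - z) \<partial>\<zeta>) = (\<integral>r. B (u - r) \<partial>\<nu>)"
proof -
  interpret pair_prob_space \<nu> \<zeta> ..
  have [measurable_cong]: "sets (\<nu> \<Otimes>\<^sub>M \<zeta>) = sets (borel \<Otimes>\<^sub>M borel)"
    by (intro sets_pair_measure_cong) auto
  have "integrable (\<nu> \<Otimes>\<^sub>M \<zeta>) (\<lambda>(r, z). indicator {u<..} (r + z) :: real)"
    by (rule integrable_const_bound[where B = 1]) auto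
  from Fubini_integral[OF this]
  have "(\<integral>z. (\<integral>r. indicator {u<..} (r + z) \<partial>\<nu>) \<partial>\<zeta>) = (\<integral>r. (\<integral>z. indicator {u<..} (r + z) \<partial>\<zeta>) \<partial>\<nu> :: real)" .
  also have "(\<lambda>z. (\<integral>r. indicator {u<..} (r + z) \<partial>\<nu>)) = (\<lambda>z. Q (u - z))"
  proof
    fix z
    have "(\<lambda>r. indicator {u<..} (r + z) :: real) = indicator {u - z<..}"
      by (auto simp: indicator_def fun_eq_iff)
    then show "(\<integral>r. indicator {u<..} (r + z) \<partial>\<nu>) = Q (u - z)" by (simp add: Q_def)
  qed
  also have "(\<lambda>r. (\<integral>z. indicator {u<..} (r + z) \<partial>\<zeta>)) = (\<lambda>r. B (u - r))"
  proof
    fix r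
    have "(\<lambda>z. indicator {u<..} (r + z) :: real) = indicator {u - r<..}"
      by (auto simp: indicator_def fun_eq_iff)
    then show "(\<integral>z. indicator {u<..} (r + z) \<partial>\<zeta>) = B (u - r)" by (simp add: B_def)
  qed
  finally show ?thesis .
qed

text \<open>Split the self-convolution by its first variable: beyond \<open>u\<close>, up to
  \<open>a\<close>, or in between. Divided by \<open>Q u\<close>, the parts are at least
  \<open>1\<close>, \<open>1 - Q a\<close> and \<open>Q (u - a) / Q u * (Q a - Q u)\<close>. The
  total tends to 2, so the ratio in the third part cannot exceed 1 in the limit.\<close>

lemma long_tailed:
  assumes "0 \<le> a"
  shows "((\<lambda>u. Q (u - a) / Q u) \<longlongrightarrow> 1) at_top"
proof (rule tendsto_sandwich[of "\<lambda>_. 1"])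
  define I where "I = (\<lambda>u. \<integral>r. Q (u - r) \<partial>\<nu>)"
  show "\<forall>\<^sub>F u in at_top. 1 \<le> Q (u - a) / Q u"
    using assms by (auto intro!: always_eventually antimonoD[OF Q_antimono] simp: Q_pos)
  have low: "Q u + Q u * (1 - Q a) + Q (u - a) * (Q a - Q u) \<le> I u" if "a \<le> u" for u
  proof -
    let ?f = "\<lambda>r. indicator {u<..} r + Q u * indicator {..a} r + Q (u - a) * (indicator {a<..} r - indicator {u<..} r) :: real"
    have a: "measure \<nu> {..a} = 1 - Q a"
      using R.prob_compl[of "{a<..}"] by (simp add: Q_def Compl_greaterThan[symmetric] Compl_eq_Diff_UNIV)
    have "(\<integral>r. ?f r \<partial>\<nu>) \<le> I u" unfolding I_def
    proof (rule integral_mono_AE[OF _ integrable_Q_R])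
      show "AE r in \<nu>. ?f r \<le> Q (u - r)"
        using R_nonneg
      proof eventually_elim
        case (elim r)
        consider "r \<le> a" | "a < r" "r \<le> u" | "u < r" by linarith
        then show ?case
        proof cases
          case 1
          then show ?thesis using that elim by (auto intro!: antimonoD[OF Q_antimono])
        next
          case 2
          then show ?thesis by (auto intro!: antimonoD[OF Q_antimono])
        next
          case 3
          then show ?thesis using that by (auto simp: Q_neg)
        qed
      qed
    qed (intro Bochner_Integration.integrable_add Bochner_Integration.integrable_diff integrable_mult_right integrable_indicators; simp)
    also have "(\<integral>r. ?f r \<partial>\<nu>) = Q u + Q u * (1 - Q a) + Q (u - a) * (Q a - Q u)"
      using a by (simp add: integrable_indicators) (simp add: Q_def)
    finally show ?thesis .
  qed
  have ev: "\<forall>\<^sub>F u in at_top. Q u < Q a"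
    using order_tendstoD(2)[OF Q_tendsto_0 Q_pos] .
  show "\<forall>\<^sub>F u in at_top. Q (u - a) / Q u \<le> (I u / Q u - 2 + Q a) / (Q a - Q u)"
    using ev eventually_ge_at_top[of a]
  proof eventually_elim
    case (elim u)
    have "Q (u - a) * (Q a - Q u) \<le> I u - 2 * Q u + Q u * Q a"
      using low[OF elim(2)] by (simp add: algebra_simps)
    then have "Q (u - a) * (Q a - Q u) / Q u \<le> (I u - 2 * Q u + Q u * Q a) / Q u"
      using Q_pos[of u] by (intro divide_right_mono) auto
    also have "\<dots> = I u / Q u - 2 + Q a"
      using Q_pos[of u] by (simp add: field_simps)
    finally show ?case using elim(1) by (simp add: pos_le_divide_eq)
  qed
  have "((\<lambda>u. (I u / Q u - 2 + Q a) / (Q a - Q u)) \<longlongrightarrow> (2 - 2 + Q a) / (Q a - 0)) at_top"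
    using Q_pos[of a] unfolding I_def by (intro tendsto_intros subexp Q_tendsto_0) auto
  then show "((\<lambda>u. (I u / Q u - 2 + Q a) / (Q a - Q u)) \<longlongrightarrow> 1) at_top"
    using Q_pos[of a] by simp
qed simp

lemma tail_ratio_shift:
  assumes "0 \<le> a"
  shows "((\<lambda>u. B (u - a) / Q u) \<longlongrightarrow> c0) at_top"
proof -
  have "filterlim (\<lambda>u. u - a) at_top at_top"
    using filterlim_tendsto_add_at_top[OF tendsto_const[of "- a"] filterlim_ident] by simp
  from tendsto_mult[OF filterlim_compose[OF tail_ratio this] long_tailed[OF assms]]
  have "((\<lambda>u. B (u - a) / Q (u - a) * (Q (u - a) / Q u)) \<longlongrightarrow> c0 * 1) at_top" .
  moreover have "(\<lambda>u. B (u - a) / Q (u - a) * (Q (u - a) / Q u)) = (\<lambda>u. B (u - a) / Q u)"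
    using Q_pos by (simp add: fun_eq_iff less_imp_neq[THEN not_sym])
  ultimately show ?thesis by simp
qed

text \<open>For independent \<open>R\<close>, \<open>Z\<close> with laws \<open>\<nu>\<close>,
  \<open>\<zeta>\<close> this is the probability of \<open>Z \<le> u < R + Z\<close>, because
  \<open>Q (u - z) = 1\<close> for \<open>z > u\<close>. It isolates the jump of \<open>R\<close>,
  which has constant 1, while the whole convolution would have constant
  \<open>1 + c0\<close>.\<close>

definition J :: "real \<Rightarrow> real" where "J u = (\<integral>z. Q (u - z) \<partial>\<zeta>) - B u"

text \<open>With \<open>Q\<close> and \<open>B\<close> exchanged by \<open>convolution_commute\<close>, the integrand is compared with
  that of the self-convolution of \<open>\<nu>\<close>; this avoids having to show that \<open>\<zeta>\<close> is subexponential.\<close>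

lemma J_le:
  assumes "0 < e"
  shows "\<forall>\<^sub>F u in at_top. J u \<le> (1 + e) * Q u"
proof -
  define d where "d = e / 2"
  have d: "0 < d" using assms by (simp add: d_def)
  have "\<forall>\<^sub>F u in at_top. B u / Q u < c0 + d"
    using d by (intro order_tendstoD[OF tail_ratio]) auto
  then obtain v1' where v1': "\<And>v. v1' \<le> v \<Longrightarrow> B v / Q v < c0 + d"
    by (auto simp: eventually_at_top_linorder)
  define v1 where "v1 = max v1' 0"
  have v1: "0 \<le> v1" "\<And>v. v1 \<le> v \<Longrightarrow> B v \<le> (c0 + d) * Q v"
    using v1' Q_pos by (auto simp: v1_def less_imp_le pos_divide_less_eq)
  define I where "I = (\<lambda>u. \<integral>r. Q (u - r) \<partial>\<nu>)"
  \<comment> \<open>For \<open>r > u - v1\<close> the trivial bound \<open>B \<le> 1\<close> is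
    used; subtracting the indicator of \<open>r > u\<close> avoids counting that range a second
    time.\<close>
  have bound: "(\<integral>r. B (u - r) \<partial>\<nu>) \<le> (c0 + d) * (I u - Q u) + Q (u - v1)" for u
  proof -
    let ?f = "\<lambda>r. (c0 + d) * (Q (u - r) - indicator {u<..} r) + indicator {u - v1<..} r :: real"
    have int: "integrable \<nu> (\<lambda>r. (c0 + d) * (Q (u - r) - indicator {u<..} r))"
      by (intro Bochner_Integration.integrable_diff integrable_mult_right integrable_Q_R integrable_indicators) simp
    have "(\<integral>r. B (u - r) \<partial>\<nu>) \<le> (\<integral>r. ?f r \<partial>\<nu>)"
    proof (rule integral_mono[OF integrable_B_R])
      fix r
      consider "r > u" | "r \<le> u" "u - v1 < r" | "r \<le> u - v1" by linarith
      then show "B (u - r) \<le> ?f r"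
      proof cases
        case 1
        then show ?thesis using v1 by (simp add: B_neg Q_neg)
      next
        case 2
        have "0 \<le> (c0 + d) * Q (u - r)" using c0_nonneg d Q_pos[of "u - r"] by simp
        then show ?thesis using 2 B_le_1[of "u - r"] by simp
      next
        case 3
        then show ?thesis using v1 by simp
      qed
    qed (intro Bochner_Integration.integrable_add int integrable_indicators, simp)
    also have "\<dots> = (\<integral>r. (c0 + d) * (Q (u - r) - indicator {u<..} r) \<partial>\<nu>) + Q (u - v1)"
      by (subst Bochner_Integration.integral_add[OF int]) (simp_all add: integrable_indicators Q_def)
    also have "(\<integral>r. (c0 + d) * (Q (u - r) - indicator {u<..} r) \<partial>\<nu>) = (c0 + d) * (I u - Q u)"
      by (simp add: Bochner_Integration.integral_diff[OF integrable_Q_R] integrable_indicators I_def)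
         (simp add: Q_def)
    finally show ?thesis .
  qed
  \<comment> \<open>The reduced self-convolution contributes \<open>c0 + d\<close>, the cut-off
    range 1, and subtracting \<open>B\<close> removes \<open>c0\<close>.\<close>
  have "((\<lambda>u. (c0 + d) * (I u / Q u - 1) + Q (u - v1) / Q u - B u / Q u) \<longlongrightarrow> (c0 + d) * (2 - 1) + 1 - c0) at_top"
    unfolding I_def by (intro tendsto_intros subexp long_tailed v1 tail_ratio)
  then have "((\<lambda>u. (c0 + d) * (I u / Q u - 1) + Q (u - v1) / Q u - B u / Q u) \<longlongrightarrow> 1 + d) at_top"
    by (simp add: add.commute[of d 1])
  then have "\<forall>\<^sub>F u in at_top. (c0 + d) * (I u / Q u - 1) + Q (u - v1) / Q u - B u / Q u < 1 + e"
    by (rule order_tendstoD) (use assms in \<open>simp add: d_def\<close>)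
  then show ?thesis
  proof eventually_elim
    case (elim u)
    have "J u \<le> (c0 + d) * (I u - Q u) + Q (u - v1) - B u"
      using bound[of u] by (simp add: J_def convolution_commute)
    also have "\<dots> = ((c0 + d) * (I u / Q u - 1) + Q (u - v1) / Q u - B u / Q u) * Q u"
      using Q_pos[of u] by (simp add: field_simps)
    also have "\<dots> \<le> (1 + e) * Q u"
      using elim Q_pos[of u] by (intro mult_right_mono) auto
    finally show ?case .
  qed
qed

section \<open>Supersolutions and their asymptotic constants\<close>

definition profile :: "(real \<Rightarrow> real) \<Rightarrow> bool" where
  "profile D \<longleftrightarrow> antimono D \<and> (\<forall>v. 0 \<le> D v \<and> D v \<le> 1) \<and> (\<forall>v<0. D v = 1)"

lemma profile_measurable: "profile D \<Longrightarrow> D \<in> borel_measurable borel"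
  by (auto simp: profile_def intro: borel_measurable_antimono)

lemma integrable_profile: "profile D \<Longrightarrow> integrable \<zeta> (\<lambda>z. D (u - z))"
  by (rule integrable_Z[where K = 1])
     (use profile_measurable[of D] in \<open>auto simp: profile_def abs_le_iff intro: order_trans[of _ 0]\<close>)

lemma integral_profile_le_1:
  assumes "profile D"
  shows "(\<integral>z. D (u - z) \<partial>\<zeta>) \<le> 1"
proof -
  have "(\<integral>z. D (u - z) \<partial>\<zeta>) \<le> (\<integral>z. 1 \<partial>\<zeta>)"
    by (rule integral_mono[OF integrable_profile[OF assms]]) (use assms in \<open>auto simp: profile_def\<close>)
  then show ?thesis using Z.prob_space by simp
qed

text \<open>Split at \<open>z = u - v0\<close>: above it \<open>D \<le> 1\<close> gives
  \<open>B (u - v0)\<close>, below it \<open>D \<le> l * Q\<close>. Discarding \<open>z > u\<close>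
  from the second part leaves \<open>l * J u\<close> instead of \<open>l\<close> times the whole
  convolution, which would count the jump of \<open>\<zeta>\<close> twice.\<close>

lemma integral_profile_le:
  assumes D: "profile D" and l: "0 \<le> l" and v0: "0 \<le> v0" "\<And>v. v0 \<le> v \<Longrightarrow> D v \<le> l * Q v"
  shows "(\<integral>z. D (u - z) \<partial>\<zeta>) \<le> B (u - v0) + l * J u"
proof -
  let ?f = "\<lambda>z. indicator {u - v0<..} z + l * (Q (u - z) - indicator {u<..} z) :: real"
  have int: "integrable \<zeta> (\<lambda>z. l * (Q (u - z) - indicator {u<..} z))"
    by (intro Bochner_Integration.integrable_diff integrable_mult_right integrable_Q_Z integrable_indicators) simp
  have "(\<integral>z. D (u - z) \<partial>\<zeta>) \<le> (\<integral>z. ?f z \<partial>\<zeta>)"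
  proof (rule integral_mono[OF integrable_profile[OF D]])
    fix z
    consider "z > u" | "z \<le> u" "u - v0 < z" | "z \<le> u - v0" by linarith
    then show "D (u - z) \<le> ?f z"
    proof cases
      case 1
      then show ?thesis using v0 D by (auto simp: profile_def Q_neg)
    next
      case 2
      have "0 \<le> l * Q (u - z)" using l Q_pos[of "u - z"] by simp
      then show ?thesis using 2 D unfolding profile_def by (smt (verit) greaterThan_iff indicator_simps)
    next
      case 3
      then show ?thesis using v0 by simp
    qed
  qed (intro Bochner_Integration.integrable_add int integrable_indicators, simp)
  also have "\<dots> = B (u - v0) + (\<integral>z. l * (Q (u - z) - indicator {u<..} z) \<partial>\<zeta>)"
    by (subst Bochner_Integration.integral_add[OF _ int]) (simp_all add: integrable_indicators B_def)
  also have "(\<integral>z. l * (Q (u - z) - indicator {u<..} z) \<partial>\<zeta>) = l * J u"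
    by (simp add: Bochner_Integration.integral_diff[OF integrable_Q_Z] integrable_indicators J_def)
       (simp add: B_def)
  finally show ?thesis .
qed

text \<open>\<open>\<beta>\<close> bounds the probability that an idle period contains an arrival before the next multiple of
  the period, and \<open>\<zeta>\<close> is the law of the time consumed by such a failed attempt.\<close>

definition supersolution :: "(real \<Rightarrow> real) \<Rightarrow> bool" where
  "supersolution D \<longleftrightarrow> profile D \<and> (\<forall>u\<ge>0. \<beta> * (\<integral>z. D (u - z) \<partial>\<zeta>) \<le> D u)"

lemma supersolution_exists: "\<exists>l\<ge>0. \<exists>D. supersolution D \<and> (\<forall>\<^sub>F u in at_top. D u \<le> l * Q u)"
proof -
  \<comment> \<open>Small enough for \<open>\<beta> * (1 + e) < 1\<close>; the slack
    \<open>\<gamma>\<close> pays for the term coming from \<open>B\<close>.\<close>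
  define e where "e = (1 - \<beta>) / 2"
  define \<gamma> where "\<gamma> = 1 - \<beta> * (1 + e)"
  have e: "0 < e" using \<beta> by (simp add: e_def)
  have "\<beta> * e \<le> e" using \<beta> e by (simp add: mult_left_le_one_le)
  then have "\<beta> * (1 + e) \<le> \<beta> + e" by (simp add: algebra_simps)
  also have "\<dots> < 1" using \<beta> unfolding e_def by argo
  finally have \<gamma>: "0 < \<gamma>" by (simp add: \<gamma>_def)
  have "\<forall>\<^sub>F u in at_top. B u / Q u < c0 + 1" by (intro order_tendstoD[OF tail_ratio]) auto
  with J_le[OF e] have "\<forall>\<^sub>F u in at_top. J u \<le> (1 + e) * Q u \<and> B u / Q u < c0 + 1" by eventually_elim simp
  then obtain u1 where u1: "\<And>u. u1 \<le> u \<Longrightarrow> J u \<le> (1 + e) * Q u" "\<And>u. u1 \<le> u \<Longrightarrow> B u / Q u < c0 + 1"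
    by (auto simp: eventually_at_top_linorder)
  \<comment> \<open>The first bound forces \<open>D = 1\<close> up to \<open>u1\<close>, where the
    inequality is trivial; the second lets \<open>A * \<gamma>\<close> absorb the contribution
    \<open>c0 + 1\<close> of \<open>B\<close> beyond \<open>u1\<close>.\<close>
  define A where "A = max (1 / Q u1) ((c0 + 1) / \<gamma>)"
  have A: "1 \<le> A" "1 \<le> A * Q u1" "c0 + 1 \<le> A * \<gamma>"
  proof -
    have "1 / Q u1 \<le> A" "(c0 + 1) / \<gamma> \<le> A" by (auto simp: A_def)
    then show "1 \<le> A * Q u1" "c0 + 1 \<le> A * \<gamma>" using Q_pos[of u1] \<gamma> by (auto simp: pos_divide_le_eq)
    then show "1 \<le> A" using Q_le_1[of u1] Q_pos[of u1] by (smt (verit) mult_left_le mult_nonpos_nonneg)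
  qed
  define D where "D = (\<lambda>v. min 1 (A * Q v))"
  have prof: "profile D"
    unfolding profile_def
  proof (intro conjI allI impI)
    show "antimono D" using A antimonoD[OF Q_antimono]
      by (auto intro!: antimonoI min.mono mult_left_mono simp: D_def simp del: min_less_iff_conj)
    show "0 \<le> D v" "D v \<le> 1" for v using A Q_pos[of v] by (auto simp: D_def)
    show "D v = 1" if "v < 0" for v using A that by (simp add: D_def Q_neg)
  qed
  have "\<beta> * (\<integral>z. D (u - z) \<partial>\<zeta>) \<le> D u" if "0 \<le> u" for u
  proof (cases "u1 \<le> u")
    case True
    have "(\<integral>z. D (u - z) \<partial>\<zeta>) \<le> B (u - 0) + A * J u"
      by (rule integral_profile_le[OF prof]) (use A in \<open>auto simp: D_def\<close>)
    also have "\<dots> \<le> (c0 + 1) * Q u + A * ((1 + e) * Q u)"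
      using u1[OF True] A Q_pos[of u] by (intro add_mono mult_left_mono) (auto simp: pos_divide_less_eq)
    finally have "\<beta> * (\<integral>z. D (u - z) \<partial>\<zeta>) \<le> \<beta> * ((c0 + 1) * Q u + A * ((1 + e) * Q u))"
      using \<beta> by (intro mult_left_mono) auto
    also have "\<dots> = (\<beta> * (c0 + 1) + A * (1 - \<gamma>)) * Q u" by (simp add: \<gamma>_def algebra_simps)
    also have "\<dots> \<le> A * Q u"
    proof (intro mult_right_mono)
      have "\<beta> * (c0 + 1) \<le> c0 + 1" using \<beta> c0_nonneg by (intro mult_left_le_one_le) auto
      then show "\<beta> * (c0 + 1) + A * (1 - \<gamma>) \<le> A" using A(3) by (simp add: algebra_simps)
    qed (use Q_pos[of u] in simp)
    finally have *: "\<beta> * (\<integral>z. D (u - z) \<partial>\<zeta>) \<le> A * Q u" .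
    have "\<beta> * (\<integral>z. D (u - z) \<partial>\<zeta>) \<le> \<beta> * 1"
      using \<beta> integral_profile_le_1[OF prof] by (intro mult_left_mono) auto
    then show ?thesis using * \<beta> unfolding D_def by simp
  next
    case False
    then have "Q u1 \<le> Q u" by (intro antimonoD[OF Q_antimono]) auto
    then have "A * Q u1 \<le> A * Q u" using A by (intro mult_left_mono) auto
    with A(2) have "D u = 1" unfolding D_def by linarith
    have "\<beta> * (\<integral>z. D (u - z) \<partial>\<zeta>) \<le> \<beta> * 1"
      using \<beta> integral_profile_le_1[OF prof] by (intro mult_left_mono) auto
    then show ?thesis using \<beta> \<open>D u = 1\<close> by simp
  qed
  then have "supersolution D" using prof by (simp add: supersolution_def)
  moreover have "\<forall>\<^sub>F u in at_top. D u \<le> A * Q u" by (auto simp: D_def)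
  ultimately show ?thesis using A by (intro exI[of _ A]) auto
qed

text \<open>\<open>T\<close> is one application of the operator, with the value 1 kept on the
  negative axis. The operator is monotone and \<open>T \<le> D\<close>, so \<open>T\<close> is again
  a supersolution. By \<open>integral_profile_le\<close> its constant collects \<open>c0\<close>
  from \<open>B\<close>, unaffected by the shift \<open>v0\<close>, and \<open>l\<close> from
  \<open>l * J\<close>.\<close>

lemma supersolution_improve:
  assumes D: "supersolution D" and l: "0 \<le> l" "\<forall>\<^sub>F u in at_top. D u \<le> l * Q u" and e: "0 < e"
  shows "\<exists>D'. supersolution D' \<and> (\<forall>\<^sub>F u in at_top. D' u \<le> \<beta> * (c0 + l + e) * Q u)"
proof -
  have prof: "profile D" using D by (simp add: supersolution_def)
  define T where "T = (\<lambda>u. if u < 0 then 1 else \<beta> * (\<integral>z. D (u - z) \<partial>\<zeta>))"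
  have T_le: "T u \<le> D u" for u
  proof (cases "u < 0")
    case True
    then show ?thesis using prof by (simp add: T_def profile_def)
  next
    case False
    then show ?thesis using D by (simp add: T_def supersolution_def)
  qed
  have int0: "0 \<le> (\<integral>z. D (u - z) \<partial>\<zeta>)" for u
    using prof by (auto simp: profile_def)
  have int1: "\<beta> * (\<integral>z. D (u - z) \<partial>\<zeta>) \<le> 1" for u
  proof -
    have "\<beta> * (\<integral>z. D (u - z) \<partial>\<zeta>) \<le> \<beta> * 1"
      using \<beta> integral_profile_le_1[OF prof] by (intro mult_left_mono) auto
    then show ?thesis using \<beta> by simp
  qed
  have anti: "(\<integral>z. D (v - z) \<partial>\<zeta>) \<le> (\<integral>z. D (u - z) \<partial>\<zeta>)" if "u \<le> v" for u v
    using prof that by (intro integral_mono integrable_profile) (auto simp: profile_def antimono_def)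
  have profT: "profile T"
    unfolding profile_def
  proof (intro conjI allI impI antimonoI)
    show "T v \<le> T u" if "u \<le> v" for u v
      using that anti[OF that] int1 \<beta> by (auto simp: T_def intro: mult_left_mono)
    show "0 \<le> T v" "T v \<le> 1" for v using int0 int1 \<beta> by (auto simp: T_def)
    show "T v = 1" if "v < 0" for v using that by (simp add: T_def)
  qed
  have "supersolution T"
    unfolding supersolution_def
  proof (intro conjI profT allI impI)
    fix u :: real assume "0 \<le> u"
    have "(\<integral>z. T (u - z) \<partial>\<zeta>) \<le> (\<integral>z. D (u - z) \<partial>\<zeta>)"
      by (intro integral_mono integrable_profile profT prof T_le)
    then show "\<beta> * (\<integral>z. T (u - z) \<partial>\<zeta>) \<le> T u"
      using \<open>0 \<le> u\<close> \<beta> by (auto simp: T_def intro: mult_left_mono)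
  qed
  moreover have "\<forall>\<^sub>F u in at_top. T u \<le> \<beta> * (c0 + l + e) * Q u"
  proof -
    obtain v0' where v0': "\<And>v. v0' \<le> v \<Longrightarrow> D v \<le> l * Q v"
      using l(2) by (auto simp: eventually_at_top_linorder)
    define v0 where "v0 = max v0' 0"
    have v0: "0 \<le> v0" "\<And>v. v0 \<le> v \<Longrightarrow> D v \<le> l * Q v" using v0' by (auto simp: v0_def)
    \<comment> \<open>Makes \<open>l * d \<le> e / 2\<close>, also for \<open>l = 0\<close>.\<close>
    define d where "d = e / (2 * (1 + l))"
    have d: "0 < d" "l * d \<le> e / 2" using e l(1) by (auto simp: d_def field_simps)
    have "\<forall>\<^sub>F u in at_top. B (u - v0) / Q u < c0 + e / 2"
      using e by (intro order_tendstoD[OF tail_ratio_shift[OF v0(1)]]) auto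
    with J_le[OF d(1)] eventually_ge_at_top[of 0] show ?thesis
    proof eventually_elim
      case (elim u)
      have "(\<integral>z. D (u - z) \<partial>\<zeta>) \<le> B (u - v0) + l * J u"
        by (rule integral_profile_le[OF prof l(1) v0])
      also have "\<dots> \<le> (c0 + e / 2) * Q u + l * ((1 + d) * Q u)"
        using elim l(1) Q_pos[of u] by (intro add_mono mult_left_mono) (auto simp: pos_divide_less_eq)
      also have "\<dots> = (c0 + e / 2 + l + l * d) * Q u" by (simp add: algebra_simps)
      also have "\<dots> \<le> (c0 + l + e) * Q u"
        using d Q_pos[of u] by (intro mult_right_mono) auto
      finally show ?case using \<beta> elim by (auto simp: T_def mult.assoc intro: mult_left_mono)
    qed
  qed
  ultimately show ?thesis by blast
qed

theorem supersolution_sharp: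
  assumes "0 < e"
  shows "\<exists>D. supersolution D \<and> (\<forall>\<^sub>F u in at_top. D u \<le> (\<beta> * c0 / (1 - \<beta>) + e) * Q u)"
proof -
  define L where "L = {l. 0 \<le> l \<and> (\<exists>D. supersolution D \<and> (\<forall>\<^sub>F u in at_top. D u \<le> l * Q u))}"
  have ne: "L \<noteq> {}" using supersolution_exists by (auto simp: L_def)
  have bdd: "bdd_below L" by (auto simp: L_def intro: bdd_belowI[of _ 0])
  define l0 where "l0 = Inf L"
  have l0: "0 \<le> l0" unfolding l0_def by (rule cInf_greatest[OF ne]) (simp add: L_def)
  have "l0 * (1 - \<beta>) \<le> \<beta> * c0"
  proof (rule ccontr)
    \<comment> \<open>The excess over the fixed-point equation
      \<open>l = \<beta> * (c0 + l)\<close>. Half of \<open>d\<close> is spent on choosing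
      \<open>l\<close> near the infimum and half on the improvement, which still ends at
      \<open>l0 - (1 - \<beta>) * d\<close>.\<close>
    define d where "d = l0 * (1 - \<beta>) - \<beta> * c0"
    assume "\<not> ?thesis"
    then have d: "0 < d" by (simp add: d_def)
    then obtain l where l: "l \<in> L" "l < l0 + d / 2"
      using cInf_lessD[OF ne, of "l0 + d / 2"] by (auto simp: l0_def)
    then obtain D where D: "supersolution D" "\<forall>\<^sub>F u in at_top. D u \<le> l * Q u" "0 \<le> l" by (auto simp: L_def)
    from supersolution_improve[OF D(1,3,2), of "d / 2"] d
    have "\<beta> * (c0 + l + d / 2) \<in> L" using \<beta> c0_nonneg D(3) by (auto simp: L_def)
    then have "l0 \<le> \<beta> * (c0 + l + d / 2)" unfolding l0_def by (intro cInf_lower bdd)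
    also have "\<dots> \<le> \<beta> * (c0 + l0 + d)" using l(2) \<beta> by (intro mult_left_mono) auto
    also have "\<dots> = l0 - (1 - \<beta>) * d" by (simp add: d_def algebra_simps)
    also have "\<dots> < l0" using d \<beta> by simp
    finally show False by simp
  qed
  then have "l0 < \<beta> * c0 / (1 - \<beta>) + e" using assms \<beta> 
    by (metis add_strict_increasing add.commute diff_gt_0_iff_gt pos_le_divide_eq)
  then obtain l where l: "l \<in> L" "l < \<beta> * c0 / (1 - \<beta>) + e"
    using cInf_lessD[OF ne] by (auto simp: l0_def)
  then obtain D where D: "supersolution D" "\<forall>\<^sub>F u in at_top. D u \<le> l * Q u" by (auto simp: L_def)
  have "\<forall>\<^sub>F u in at_top. D u \<le> (\<beta> * c0 / (1 - \<beta>) + e) * Q u"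
    using D(2)
  proof eventually_elim
    case (elim u)
    have "l * Q u \<le> (\<beta> * c0 / (1 - \<beta>) + e) * Q u" using l(2) Q_pos[of u] by (intro mult_right_mono) auto
    with elim show ?case by simp
  qed
  with D(1) show ?thesis by blast
qed

end

section \<open>Comparison of the slotted queue with a supersolution\<close>

locale slotted_queue = real_distribution \<mu> for \<mu> :: "real measure" +
  fixes h q :: real and K :: nat
  assumes AE_mark_nonneg: "AE s in \<mu>. 0 \<le> s"
    and h_pos: "0 < h" and K_pos: "0 < K" and q: "0 \<le> q" "q \<le> 1"
begin

text \<open>\<open>obs\<close> may idle and is tested only when the number of remaining slots is a
  multiple of \<open>K\<close>; \<open>busy\<close> is killed as soon as it is nonpositive, so it
  needs no reflection.\<close>

sublocale obs: slotted_chain \<mu> "\<lambda>n x. K dvd n \<longrightarrow> 0 < x" "\<lambda>x. max x 0" h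
  by unfold_locales (use AE_mark_nonneg in auto)

sublocale busy: slotted_chain \<mu> "\<lambda>n x. 0 < x" "\<lambda>x. x" h
  by unfold_locales (use AE_mark_nonneg in auto)

abbreviation "bern \<equiv> \<lambda>(_::nat) c. if c then q else 1 - q"

lemma weights_bern: "weights bern"
  using q by (simp add: weights_def)

text \<open>\<open>f n x\<close> is the probability of never being empty at a multiple of the period during \<open>n\<close> slots,
  and \<open>b n x\<close> the probability that the initial busy period outlasts \<open>n\<close> slots.\<close>

abbreviation "f n \<equiv> obs.val n bern"
abbreviation "b n \<equiv> busy.val n bern"

lemma f_nonpos: "x \<le> 0 \<Longrightarrow> f n x = f n 0"
  by (cases n) simp_all

section \<open>Busy periods weighed against a tail function \<open>D\<close>\<close>

context
  fixes D :: "real \<Rightarrow> real"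
  assumes D_antimono: "antimono D" and D_range: "\<And>v. 0 \<le> D v" "\<And>v. D v \<le> 1"
    and D_neg: "\<And>v. v < 0 \<Longrightarrow> D v = 1"
begin

text \<open>\<open>\<Phi> n x\<close> is the expectation of \<open>D\<close> at the time that is left when the busy period started in
  state \<open>x\<close> ends, summed by parts so that only the tail \<open>b\<close> of the busy period enters.\<close>

definition \<Phi> :: "nat \<Rightarrow> real \<Rightarrow> real" where
  "\<Phi> n x = D (n * h) + (\<Sum>k\<le>n. b k x * (D ((real n - real k - 1) * h) - D ((real n - real k) * h)))"

lemma D_diff_nonneg: "0 \<le> D ((real n - real k - 1) * h) - D ((real n - real k) * h)"
  using antimonoD[OF D_antimono, of "(real n - real k - 1) * h" "(real n - real k) * h"] h_pos by simp

lemma b_nonpos: "x \<le> 0 \<Longrightarrow> b k x = 0"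
  by (cases k) simp_all

lemma \<Phi>_nonpos: "x \<le> 0 \<Longrightarrow> \<Phi> n x = D (n * h)"
  by (simp add: \<Phi>_def b_nonpos)

lemma integrable_b: "integrable \<mu> (\<lambda>s. b k (x + s - h))"
  by (rule busy.val_integrable[OF weights_bern])

lemma integral_\<Phi>:
  "(\<integral>s. \<Phi> n (x + s - h) \<partial>\<mu>) =
     D (n * h) + (\<Sum>k\<le>n. (\<integral>s. b k (x + s - h) \<partial>\<mu>) * (D ((real n - real k - 1) * h) - D ((real n - real k) * h)))"
  unfolding \<Phi>_def using prob_space
  by (subst Bochner_Integration.integral_add)
     (auto simp: integrable_b Bochner_Integration.integral_sum)

lemma integrable_\<Phi>: "integrable \<mu> (\<lambda>s. \<Phi> n (x + s - h))"
  unfolding \<Phi>_def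
  by (intro Bochner_Integration.integrable_add Bochner_Integration.integrable_sum integrable_mult_left integrable_b) simp

text \<open>\<open>b\<close> obeys the first-step recursion of the busy chain, and the term
  \<open>k = 0\<close>, where \<open>b 0 x = 1\<close>, turns \<open>D ((n + 1) * h)\<close> into
  \<open>D (n * h)\<close>. So \<open>\<Phi>\<close> is harmonic while the server is busy, which
  carries the induction through a busy period.\<close>

lemma \<Phi>_Suc:
  assumes "0 < x"
  shows "\<Phi> (Suc n) x = (1 - q) * \<Phi> n (x - h) + q * (\<integral>s. \<Phi> n (x + s - h) \<partial>\<mu>)"
proof -
  let ?d = "\<lambda>k. D ((real n - real k - 1) * h) - D ((real n - real k) * h)"
  let ?i = "\<lambda>k. \<integral>s. b k (x + s - h) \<partial>\<mu>"
  have b0: "b 0 x = 1" using assms by simp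
  have "\<Phi> (Suc n) x = D (Suc n * h) + (b 0 x * (D (n * h) - D (Suc n * h)) + (\<Sum>k\<le>n. b (Suc k) x * ?d k))"
    unfolding \<Phi>_def sum.atMost_Suc_shift by (simp add: algebra_simps)
  also have "\<dots> = D (n * h) + (\<Sum>k\<le>n. b (Suc k) x * ?d k)" unfolding b0 by simp
  also have "(\<Sum>k\<le>n. b (Suc k) x * ?d k) = (\<Sum>k\<le>n. (1 - q) * (b k (x - h) * ?d k) + q * (?i k * ?d k))"
    using assms by (intro sum.cong) (simp_all add: distrib_right mult.assoc)
  also have "\<dots> = (1 - q) * (\<Sum>k\<le>n. b k (x - h) * ?d k) + q * (\<Sum>k\<le>n. ?i k * ?d k)"
    by (simp add: sum.distrib sum_distrib_left)
  finally show ?thesis unfolding integral_\<Phi> by (simp add: \<Phi>_def algebra_simps)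
qed

text \<open>For a deterministic busy period \<open>y\<close> the sum telescopes to \<open>D\<close>
  at \<open>m - j\<close> slots, where \<open>j\<close> counts the boundaries
  \<open>k * h < y\<close> and is at most \<open>y / h + 1\<close>; the extra \<open>h\<close> on
  the right is this rounding. If \<open>y\<close> exceeds \<open>m * h\<close>, the right-hand side
  is 1.\<close>

lemma telescope_le:
  assumes "- h \<le> y"
  shows "D (m * h) + (\<Sum>k\<le>m. of_bool (k * h < y) * (D ((real m - real k - 1) * h) - D ((real m - real k) * h)))
    \<le> D (m * h - h - y)"
  using assms
proof (induction m arbitrary: y)
  case 0
  show ?case
  proof (cases "0 < y")
    case True
    then show ?thesis using h_pos by (simp add: D_neg)
  next
    case False
    then show ?thesis using 0 by (auto intro!: antimonoD[OF D_antimono])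
  qed
next
  case (Suc m)
  show ?case
  proof (cases "0 < y")
    case True
    let ?d = "\<lambda>k. D ((real m - real k - 1) * h) - D ((real m - real k) * h)"
    have "D (Suc m * h) + (\<Sum>k\<le>Suc m. of_bool (k * h < y) * (D ((real (Suc m) - real k - 1) * h) - D ((real (Suc m) - real k) * h)))
      = D (m * h) + (\<Sum>k\<le>m. of_bool (k * h < y - h) * ?d k)"
      unfolding sum.atMost_Suc_shift using True by (simp add: algebra_simps)
    also have "\<dots> \<le> D (m * h - h - (y - h))"
      using True by (intro Suc.IH) simp
    finally show ?thesis by (simp add: algebra_simps)
  next
    case False
    then have "\<not> real k * h < y" for k
      using h_pos by (smt (verit) mult_nonneg_nonneg of_nat_0_le_iff)
    then show ?thesis using Suc.prems by (auto intro!: antimonoD[OF D_antimono])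
  qed
qed

text \<open>\<open>\<zeta>\<close> stands for a busy period plus \<open>K * h\<close> for the slots
  elapsed before it and \<open>h\<close> for the rounding in \<open>telescope_le\<close>. The bound
  on the busy tail stops at \<open>nmax\<close> because the discretization error grows with the
  number of slots.\<close>

context
  fixes \<zeta> :: "real measure" and \<beta> err :: real and nmax :: nat
  assumes \<zeta>: "real_distribution \<zeta>" and \<zeta>_ge: "AE z in \<zeta>. K * h + h \<le> z"
    and \<beta>: "1 - (1 - q) ^ K \<le> \<beta>" "\<beta> < 1" and err: "0 \<le> err"
    and supersol: "\<And>u. 0 \<le> u \<Longrightarrow> \<beta> * (\<integral>z. D (u - z) \<partial>\<zeta>) \<le> D u"
    and busy_tail: "\<And>k. k \<le> nmax \<Longrightarrow> (\<integral>s. b k (s - h) \<partial>\<mu>) \<le> measure \<zeta> {k * h + (K * h + h)<..} + err"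
begin

interpretation Z: real_distribution \<zeta> by (rule \<zeta>)

lemma D_measurable [measurable]: "D \<in> borel_measurable borel"
  by (rule borel_measurable_antimono[OF D_antimono])

lemma integrable_D: "integrable \<zeta> (\<lambda>z. D (u - z))"
proof (rule Z.integrable_const_bound[where B = 1])
  show "(\<lambda>z. D (u - z)) \<in> borel_measurable \<zeta>"
    by (rule Z.measurable_finite_borel) measurable
  show "AE z in \<zeta>. norm (D (u - z)) \<le> 1"
    by (rule AE_I2) (simp only: real_norm_def abs_of_nonneg[OF D_range(1)] D_range(2))
qed

lemma integral_D_nonneg: "0 \<le> (\<integral>z. D (u - z) \<partial>\<zeta>)"
  by (rule Bochner_Integration.integral_nonneg) (rule D_range)

text \<open>This undoes the summation by parts: the busy tail is replaced by that of
  \<open>\<zeta>\<close>, the sum moves under the integral, and \<open>telescope_le\<close> applies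
  pointwise with \<open>y = z - (K * h + h)\<close>. The offset \<open>K * h\<close> pays for
  passing from \<open>m\<close> to \<open>n\<close>. The differences of \<open>D\<close> add up to
  at most 1, so \<open>err\<close> is paid once.\<close>

lemma integral_\<Phi>_le:
  assumes m: "m \<le> nmax" "m < n" "n \<le> m + K"
  shows "(\<integral>s. \<Phi> m (s - h) \<partial>\<mu>) \<le> (\<integral>z. D (n * h - z) \<partial>\<zeta>) + err"
proof -
  let ?d = "\<lambda>k. D ((real m - real k - 1) * h) - D ((real m - real k) * h)"
  let ?c = "K * h + h"
  have sum_d: "(\<Sum>k\<le>m. ?d k) \<le> 1"
  proof -
    have "(\<Sum>k\<le>j. ?d k) = D ((real m - real j - 1) * h) - D (m * h)" for j
      by (induction j) (auto simp: algebra_simps)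
    then show ?thesis using D_range[of "m * h"] D_range(2)[of "(real m - real m - 1) * h"] by simp
  qed
  have "(\<integral>s. \<Phi> m (s - h) \<partial>\<mu>) = D (m * h) + (\<Sum>k\<le>m. (\<integral>s. b k (s - h) \<partial>\<mu>) * ?d k)"
    using integral_\<Phi>[of m 0] by simp
  also have "\<dots> \<le> D (m * h) + (\<Sum>k\<le>m. (measure \<zeta> {k * h + ?c<..} + err) * ?d k)"
    by (intro add_left_mono sum_mono mult_right_mono busy_tail D_diff_nonneg) (use m in auto)
  also have "\<dots> = D (m * h) + (\<Sum>k\<le>m. measure \<zeta> {k * h + ?c<..} * ?d k) + err * (\<Sum>k\<le>m. ?d k)"
    by (simp only: distrib_right sum.distrib sum_distrib_left add.assoc)
  also have "err * (\<Sum>k\<le>m. ?d k) \<le> err"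
    using sum_d err by (simp add: mult_left_le)
  also have "D (m * h) + (\<Sum>k\<le>m. measure \<zeta> {k * h + ?c<..} * ?d k) =
    (\<integral>z. D (m * h) + (\<Sum>k\<le>m. indicator {k * h + ?c<..} z * ?d k) \<partial>\<zeta>)"
  proof -
    have "integrable \<zeta> (indicator {k * h + ?c<..} :: real \<Rightarrow> real)" for k
      by (rule Z.integrable_const_bound[where B = 1]) auto
    then have int: "integrable \<zeta> (\<lambda>z. indicator {k * h + ?c<..} z * ?d k)" for k
      by (intro integrable_mult_left)
    have "(\<integral>z. (\<Sum>k\<le>m. indicator {k * h + ?c<..} z * ?d k) \<partial>\<zeta>) = (\<Sum>k\<le>m. measure \<zeta> {k * h + ?c<..} * ?d k)"
      by (subst Bochner_Integration.integral_sum[OF int]) simp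
    then show ?thesis using Z.prob_space
      by (subst Bochner_Integration.integral_add[OF _ Bochner_Integration.integrable_sum[OF int]])
         (simp_all only: Z.integrable_const, simp)
  qed
  also have "\<dots> \<le> (\<integral>z. D (n * h - z) \<partial>\<zeta>)"
  proof (rule integral_mono_AE[OF _ integrable_D])
    have "integrable \<zeta> (indicator {k * h + ?c<..} :: real \<Rightarrow> real)" for k
      by (rule Z.integrable_const_bound[where B = 1]) auto
    then show "integrable \<zeta> (\<lambda>z. D (m * h) + (\<Sum>k\<le>m. indicator {k * h + ?c<..} z * ?d k))"
      by (intro Bochner_Integration.integrable_add Bochner_Integration.integrable_sum integrable_mult_left) auto
    show "AE z in \<zeta>. D (m * h) + (\<Sum>k\<le>m. indicator {k * h + ?c<..} z * ?d k) \<le> D (n * h - z)"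
      using \<zeta>_ge
    proof eventually_elim
      case (elim z)
      have "D (m * h) + (\<Sum>k\<le>m. indicator {k * h + ?c<..} z * ?d k) =
        D (m * h) + (\<Sum>k\<le>m. of_bool (k * h < z - ?c) * ?d k)"
        by (intro arg_cong2[where f = "(+)"] refl sum.cong) (auto simp: indicator_def)
      also have "\<dots> \<le> D (m * h - h - (z - ?c))"
        by (rule telescope_le) (use elim h_pos in simp)
      also have "\<dots> \<le> D (n * h - z)"
      proof (rule antimonoD[OF D_antimono])
        have "real n * h \<le> real (m + K) * h" using m h_pos by (intro mult_right_mono) auto
        then show "n * h - z \<le> m * h - h - (z - ?c)" by (simp add: algebra_simps)
      qed
      finally show ?case .
    qed
  qed
  finally show ?thesis by simp
qed

text \<open>An error \<open>err\<close> is made in each busy cycle, and the chain continues with probability at most \<open>\<beta>\<close>.\<close>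

definition "\<epsilon> = err / (1 - \<beta>)"

text \<open>An idle chain is killed at the next observation, \<open>n mod K\<close> slots away, so
  only an arrival before it contributes. That has probability at most \<open>\<beta>\<close>, and
  after it the induction hypothesis and \<open>integral_\<Phi>_le\<close> bound the rest by
  \<open>C\<close>.\<close>

lemma idle_bound:
  assumes n: "n \<le> nmax" and IH: "\<And>m x. m < n \<Longrightarrow> f m x \<le> \<Phi> m x + \<epsilon>"
  shows "f n 0 \<le> D (n * h) + \<epsilon>"
proof -
  define C where "C = (\<integral>z. D (n * h - z) \<partial>\<zeta>) + err + \<epsilon>"
  have \<epsilon>: "0 \<le> \<epsilon>" using err \<beta> by (simp add: \<epsilon>_def)
  have C: "0 \<le> C" using integral_D_nonneg err \<epsilon> by (simp add: C_def)
  have fint: "integrable \<mu> (\<lambda>s. f m (s - h))" for m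
    using obs.val_integrable[OF weights_bern, of m 0] by simp
  have \<Phi>int: "integrable \<mu> (\<lambda>s. \<Phi> m (s - h))" for m
    using integrable_\<Phi>[of m 0] by simp
  have fC: "(\<integral>s. f m (s - h) \<partial>\<mu>) \<le> C" if "m < n" "n \<le> m + K" for m
  proof -
    have "(\<integral>s. f m (s - h) \<partial>\<mu>) \<le> (\<integral>s. \<Phi> m (s - h) + \<epsilon> \<partial>\<mu>)"
      by (intro integral_mono fint Bochner_Integration.integrable_add \<Phi>int IH that) simp
    also have "\<dots> = (\<integral>s. \<Phi> m (s - h) \<partial>\<mu>) + \<epsilon>"
      using prob_space by (subst Bochner_Integration.integral_add) (auto simp: \<Phi>int)
    also have "\<dots> \<le> C" using integral_\<Phi>_le[of m n] that n by (simp add: C_def)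
    finally show ?thesis .
  qed
  have step: "f n 0 \<le> (1 - (1 - q) ^ i) * C + (1 - q) ^ i * f (n - i) 0" if "i \<le> n mod K" for i
    using that
  proof (induction i)
    case (Suc i)
    have nK: "n mod K \<le> n" "n mod K < K" using K_pos by auto
    obtain m where m: "n - i = Suc m" using Suc.prems nK by (metis Suc_diff_Suc Suc_le_lessD less_le_trans)
    have ndvd: "\<not> K dvd n - i"
    proof
      assume "K dvd n - i"
      then have "(i + (n - i)) mod K = i mod K" by (auto elim!: dvdE)
      then show False using Suc.prems nK by simp
    qed
    have "f (n - i) 0 = (1 - q) * f m 0 + q * (\<integral>s. f m (s - h) \<partial>\<mu>)"
      unfolding m using ndvd m h_pos by (simp add: f_nonpos[of "- h"])
    also have "\<dots> \<le> (1 - q) * f m 0 + q * C"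
      using m Suc.prems nK q by (intro add_left_mono mult_left_mono fC) auto
    finally have "f (n - i) 0 \<le> (1 - q) * f m 0 + q * C" .
    moreover have "m = n - Suc i" using m by simp
    ultimately have "f (n - i) 0 \<le> (1 - q) * f (n - Suc i) 0 + q * C" by (simp only:)
    then have "(1 - q) ^ i * f (n - i) 0 \<le> (1 - q) ^ i * ((1 - q) * f (n - Suc i) 0 + q * C)"
      using q by (intro mult_left_mono) auto
    with Suc.IH Suc.prems show ?case by (simp add: algebra_simps)
  qed simp
  have "f m 0 = 0" if "K dvd m" for m
    using that by (cases m) simp_all
  then have "f (n - n mod K) 0 = 0" by (simp only: dvd_minus_mod)
  with step[of "n mod K"] have "f n 0 \<le> (1 - (1 - q) ^ (n mod K)) * C" by simp
  also have "\<dots> \<le> \<beta> * C"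
  proof (intro mult_right_mono C)
    have "(1 - q) ^ K \<le> (1 - q) ^ (n mod K)" using q K_pos by (intro power_decreasing) (auto simp: less_imp_le)
    then show "1 - (1 - q) ^ (n mod K) \<le> \<beta>" using \<beta> by simp
  qed
  also have "\<dots> = \<beta> * (\<integral>z. D (n * h - z) \<partial>\<zeta>) + \<beta> * (err + \<epsilon>)" by (simp add: C_def algebra_simps)
  also have "\<beta> * (\<integral>z. D (n * h - z) \<partial>\<zeta>) \<le> D (n * h)" using h_pos by (intro supersol) simp
  \<comment> \<open>With \<open>err = (1 - \<beta>) * \<epsilon>\<close> the left side is
    \<open>(1 - (1 - \<beta>)^2) * \<epsilon>\<close>.\<close>
  also have "\<beta> * (err + \<epsilon>) \<le> \<epsilon>"
  proof -
    have *: "err = (1 - \<beta>) * \<epsilon>" using \<beta> by (simp add: \<epsilon>_def)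
    have "\<epsilon> - \<beta> * ((1 - \<beta>) * \<epsilon> + \<epsilon>) = (1 - \<beta>) * (1 - \<beta>) * \<epsilon>" by (simp add: algebra_simps)
    then have "\<epsilon> - \<beta> * (err + \<epsilon>) = (1 - \<beta>) * (1 - \<beta>) * \<epsilon>"
      by (simp only: *[symmetric])
    also have "0 \<le> \<dots>" using \<epsilon> \<beta> by simp
    finally show ?thesis by simp
  qed
  finally show ?thesis by simp
qed

text \<open>Nonpositive states are covered by \<open>idle_bound\<close>; in positive states
  \<open>f\<close> and \<open>\<Phi>\<close> obey the same first-step equation. At
  \<open>n = 0\<close> the bound is 1, because \<open>D (- h) = 1\<close>.\<close>

lemma f_le_\<Phi>: "n \<le> nmax \<Longrightarrow> f n x \<le> \<Phi> n x + \<epsilon>"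
proof (induction n arbitrary: x rule: less_induct)
  case (less n)
  have \<epsilon>: "0 \<le> \<epsilon>" using err \<beta> by (simp add: \<epsilon>_def)
  have IH: "f m x \<le> \<Phi> m x + \<epsilon>" if "m < n" for m x
    by (rule less.IH[OF that]) (use that less.prems in linarith)
  show ?case
  proof (cases "x \<le> 0")
    case True
    have "f n 0 \<le> D (n * h) + \<epsilon>" by (rule idle_bound[OF less.prems IH])
    then show ?thesis using True by (simp only: f_nonpos[OF True] \<Phi>_nonpos[OF True])
  next
    case False
    show ?thesis
    proof (cases n)
      case 0
      have "D (- h) = 1" using h_pos by (intro D_neg) simp
      then show ?thesis using False \<epsilon> 0 by (simp add: \<Phi>_def)
    next
      case (Suc m)
      have "f n x = of_bool (K dvd n \<longrightarrow> 0 < x) * ((1 - q) * f m (x - h) + q * (\<integral>s. f m (x + s - h) \<partial>\<mu>))"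
        using Suc False by simp
      also have "\<dots> = (1 - q) * f m (x - h) + q * (\<integral>s. f m (x + s - h) \<partial>\<mu>)"
        using False by simp
      also have "\<dots> \<le> (1 - q) * (\<Phi> m (x - h) + \<epsilon>) + q * (\<integral>s. \<Phi> m (x + s - h) + \<epsilon> \<partial>\<mu>)"
      proof (intro add_mono mult_left_mono)
        have m: "m < n" using Suc by simp
        show "f m (x - h) \<le> \<Phi> m (x - h) + \<epsilon>" by (rule IH[OF m])
        show "(\<integral>s. f m (x + s - h) \<partial>\<mu>) \<le> (\<integral>s. \<Phi> m (x + s - h) + \<epsilon> \<partial>\<mu>)"
          by (intro integral_mono obs.val_integrable[OF weights_bern] IH[OF m]
              Bochner_Integration.integrable_add integrable_\<Phi> integrable_const)
      qed (use q in simp_all)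
      also have "(\<integral>s. \<Phi> m (x + s - h) + \<epsilon> \<partial>\<mu>) = (\<integral>s. \<Phi> m (x + s - h) \<partial>\<mu>) + \<epsilon>"
        using prob_space by (subst Bochner_Integration.integral_add) (auto simp: integrable_\<Phi>)
      finally show ?thesis using \<Phi>_Suc[of x m] False Suc by (simp add: algebra_simps)
    qed
  qed
qed

lemma f_zero_le: "n \<le> nmax \<Longrightarrow> f n 0 \<le> D (n * h) + err / (1 - \<beta>)"
  using f_le_\<Phi>[of n 0] by (simp add: \<Phi>_nonpos \<epsilon>_def)

end

end

end

section \<open>Workload paths and Poisson cells\<close>

lemma arr_time_le:
  assumes "0 \<le> t" "k \<le> n t"
  shows "arr_time n k \<le> t"
  using assms by (auto simp: arr_time_def intro!: cInf_lower bdd_belowI[of _ 0])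

text \<open>Each arrival is counted as joining, and at time \<open>t\<close>, when none of its
  service has been worked off; both only increase the bound. This removes the balking variables from
  the argument.\<close>

lemma workload_increment_le:
  assumes n: "mono_on {0..} n" and st: "0 \<le> s" "s \<le> t" and S: "\<And>i. 0 \<le> S (Suc i)"
  shows "workload n w0 S Y t \<le> max (workload n w0 S Y s - (t - s)) 0 + (\<Sum>i\<in>{n s..<n t}. S (Suc i))"
proof -
  let ?T = "arr_time n" and ?A = "wl_after (arr_time n) w0 S Y"
  have "n s \<le> n t" using n st by (auto intro: mono_onD)
  then have "max (?A (n t) - (t - ?T (n t))) 0 \<le> max (workload n w0 S Y s - (t - s)) 0 + (\<Sum>i\<in>{n s..<n t}. S (Suc i))"
  proof (induction rule: dec_induct)
    case base
    show ?case by (auto simp: workload_def)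
  next
    case (step k)
    have T: "?T (Suc k) \<le> t" using step st by (intro arr_time_le) auto
    define v where "v = max (?A k - (?T (Suc k) - ?T k)) 0"
    have "?A (Suc k) \<le> v + S (Suc k)" using S[of k] by (simp add: v_def Let_def)
    then have "max (?A (Suc k) - (t - ?T (Suc k))) 0 \<le> max (?A k - (t - ?T k)) 0 + S (Suc k)"
      using T S[of k] by (auto simp: v_def)
    also have "\<dots> \<le> max (workload n w0 S Y s - (t - s)) 0 + (\<Sum>i\<in>{n s..<k}. S (Suc i)) + S (Suc k)"
      by (rule add_right_mono[OF step.IH])
    also have "\<dots> = max (workload n w0 S Y s - (t - s)) 0 + (\<Sum>i\<in>{n s..<Suc k}. S (Suc i))"
      using step.hyps by simp
    finally show ?case .
  qed
  then show ?thesis by (simp add: workload_def)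
qed

text \<open>Patience \<open>\<infinity>\<close> makes everybody join, and ignoring the reflection at
  0 can only lower the path.\<close>

lemma workload_ge:
  assumes "0 \<le> t"
  shows "w0 + (\<Sum>i<n t. S (Suc i)) - t \<le> workload n w0 S (\<lambda>_. \<infinity>) t"
proof -
  let ?T = "arr_time n" and ?A = "wl_after (arr_time n) w0 S (\<lambda>_. \<infinity>)"
  have "w0 + (\<Sum>i<k. S (Suc i)) - ?T k \<le> ?A k" for k
  proof (induction k)
    case 0
    then show ?case by (simp add: arr_time_def)
  next
    case (Suc k)
    then show ?case by (simp add: Let_def)
  qed
  from this[of "n t"] show ?thesis by (simp add: workload_def)
qed

text \<open>Pathwise domination by induction over the slots, with a running start slot
  \<open>j\<close>. A mark is consumed even if its customer balks, so the marks stay aligned with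
  the arrival count.\<close>

lemma survives_obs:
  assumes n: "mono_on {0..} n" and h: "0 < h" and S: "\<And>i. 0 \<le> S (Suc i)"
    and cells: "\<And>i. i < length cs \<Longrightarrow> n (real (Suc (j + i)) * h) = n (real (j + i) * h) + of_bool (cs ! i)"
    and busy: "\<And>i. i \<le> length cs \<Longrightarrow> K dvd length cs - i \<Longrightarrow> h < workload n w0 S Y (real (j + i) * h)"
    and x: "workload n w0 S Y (real j * h) - h \<le> x"
  shows "survives (\<lambda>n x. K dvd n \<longrightarrow> 0 < x) (\<lambda>x. max x 0) h cs x (\<lambda>i. S (Suc (n (real j * h) + i)))"
  using cells busy x
proof (induction cs arbitrary: j x)
  case Nil
  then show ?case by fastforce
next
  case (Cons c cs)
  let ?W = "workload n w0 S Y"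
  have c: "n (real (Suc j) * h) = n (real j * h) + of_bool c" using Cons.prems(1)[of 0] by simp
  define X where "X = (if c then S (Suc (n (real j * h))) else 0)"
  have "?W (real (Suc j) * h) \<le> max (?W (real j * h) - (real (Suc j) * h - real j * h)) 0 +
     (\<Sum>i\<in>{n (real j * h)..<n (real (Suc j) * h)}. S (Suc i))"
    using h S by (intro workload_increment_le n) (auto intro!: mult_right_mono)
  also have "(\<Sum>i\<in>{n (real j * h)..<n (real (Suc j) * h)}. S (Suc i)) = X"
    unfolding c by (simp add: X_def)
  also have "real (Suc j) * h - real j * h = h" by (simp add: algebra_simps)
  finally have W: "?W (real (Suc j) * h) - h \<le> max x 0 + X - h" using Cons.prems(3) by linarith
  have "survives (\<lambda>n x. K dvd n \<longrightarrow> 0 < x) (\<lambda>x. max x 0) h cs (max x 0 + X - h) (\<lambda>i. S (Suc (n (real (Suc j) * h) + i)))"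
  proof (rule Cons.IH[OF _ _ W])
    show "n (real (Suc (Suc j + i)) * h) = n (real (Suc j + i) * h) + of_bool (cs ! i)" if "i < length cs" for i
      using Cons.prems(1)[of "Suc i"] that by simp
    show "h < ?W (real (Suc j + i) * h)" if "i \<le> length cs" "K dvd length cs - i" for i
      using Cons.prems(2)[of "Suc i"] that by simp
  qed
  moreover have "0 < x" if "K dvd Suc (length cs)"
    using Cons.prems(2)[of 0] Cons.prems(3) that by simp
  ultimately show ?case unfolding c by (cases c) (simp_all add: X_def)
qed

text \<open>While the chain is alive there is no reflection, so its state is \<open>x\<close> plus
  the net input and is positive at each boundary.\<close>

lemma survives_busy:
  assumes "survives (\<lambda>n x. 0 < x) (\<lambda>x. x) h cs x (\<lambda>i. S (Suc (n (real j * h) + i)))"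
    and "\<And>i. i < length cs \<Longrightarrow> n (real (Suc (j + i)) * h) = n (real (j + i) * h) + of_bool (cs ! i)"
    and "i \<le> length cs"
  shows "0 < x + (\<Sum>l\<in>{n (real j * h)..<n (real (j + i) * h)}. S (Suc l)) - real i * h"
  using assms
proof (induction cs arbitrary: j x i)
  case Nil
  then show ?case by simp
next
  case (Cons c cs)
  have c: "n (real (Suc j) * h) = n (real j * h) + of_bool c" using Cons.prems(2)[of 0] by simp
  define X where "X = (if c then S (Suc (n (real j * h))) else 0)"
  show ?case
  proof (cases i)
    case 0
    then show ?thesis using Cons.prems(1) by simp
  next
    case (Suc i')
    have mono: "n (real (Suc j) * h) \<le> n (real (Suc j + i') * h)" if "i' \<le> length cs" for i'
      using that
    proof (induction i')
      case (Suc i')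
      then show ?case using Cons.prems(2)[of "Suc i'"] by simp
    qed simp
    have "0 < (x + X - h) + (\<Sum>l\<in>{n (real (Suc j) * h)..<n (real (Suc j + i') * h)}. S (Suc l)) - real i' * h"
    proof (rule Cons.IH)
      show "survives (\<lambda>n x. 0 < x) (\<lambda>x. x) h cs (x + X - h) (\<lambda>i. S (Suc (n (real (Suc j) * h) + i)))"
        using Cons.prems(1) unfolding c by (cases c) (simp_all add: X_def)
      show "n (real (Suc (Suc j + i)) * h) = n (real (Suc j + i) * h) + of_bool (cs ! i)" if "i < length cs" for i
        using Cons.prems(2)[of "Suc i"] that by simp
    qed (use Cons.prems(3) Suc in simp)
    moreover have "(\<Sum>l\<in>{n (real j * h)..<n (real (Suc j + i') * h)}. S (Suc l)) =
       X + (\<Sum>l\<in>{n (real (Suc j) * h)..<n (real (Suc j + i') * h)}. S (Suc l))"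
    proof -
      have "(\<Sum>l\<in>{n (real j * h)..<n (real (Suc j + i') * h)}. S (Suc l)) =
        (\<Sum>l\<in>{n (real j * h)..<n (real (Suc j) * h)}. S (Suc l)) +
        (\<Sum>l\<in>{n (real (Suc j) * h)..<n (real (Suc j + i') * h)}. S (Suc l))"
        using mono[of i'] Cons.prems(3) Suc c by (intro sum.atLeastLessThan_concat[symmetric]) auto
      then show ?thesis unfolding c by (simp add: X_def)
    qed
    ultimately show ?thesis using Suc by (simp add: algebra_simps)
  qed
qed

text \<open>Opposite in direction to \<open>survives_obs\<close>: the true busy period must outlast
  the chain. A positive state at the left end of a slot means more than \<open>h\<close> of net
  work, which keeps the workload positive throughout the slot; further arrivals only help.\<close>

lemma busy_period_greater:
  fixes h :: real
  assumes n: "mono_on {0..} n" "n 0 = 0" and h: "0 < h" and S: "\<And>i. 0 \<le> S (Suc i)"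
    and surv: "survives (\<lambda>n x. 0 < x) (\<lambda>x. x) h cs (w0 - h) (\<lambda>i. S (Suc i))"
    and cells: "\<And>i. i < length cs \<Longrightarrow> n (real (Suc i) * h) = n (real i * h) + of_bool (cs ! i)"
  shows "ereal (length cs * h) < busy_period (workload n w0 S (\<lambda>_. \<infinity>))"
proof -
  let ?k = "length cs"
  have "ereal (Suc ?k * h) \<le> busy_period (workload n w0 S (\<lambda>_. \<infinity>))"
    unfolding busy_period_def
  proof (rule Inf_greatest)
    fix y assume "y \<in> {ereal t |t. 0 < t \<and> workload n w0 S (\<lambda>_. \<infinity>) t = 0}"
    then obtain t where t: "y = ereal t" "0 < t" "workload n w0 S (\<lambda>_. \<infinity>) t = 0" by auto
    have "Suc ?k * h \<le> t"
    proof (rule ccontr)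
      assume "\<not> ?thesis"
      then have "t < Suc ?k * h" by simp
      define i where "i = nat \<lfloor>t / h\<rfloor>"
      have i: "real i * h \<le> t" "t < (real i + 1) * h"
        using h t by (auto simp: i_def pos_le_divide_eq[symmetric] pos_divide_less_eq[symmetric])
      have "real i * h < Suc ?k * h" using i(1) \<open>t < Suc ?k * h\<close> by simp
      then have "real i < real (Suc ?k)" using h by (simp only: mult_less_cancel_right_pos)
      then have "i \<le> ?k" by simp
      then have "0 < (w0 - h) + (\<Sum>l\<in>{n (real 0 * h)..<n (real (0 + i) * h)}. S (Suc l)) - real i * h"
        using surv cells n by (intro survives_busy[of h cs]) auto
      then have "0 < w0 + (\<Sum>l<n (real i * h). S (Suc l)) - (real i + 1) * h"
        using n by (simp add: atLeast0LessThan algebra_simps)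
      also have "\<dots> \<le> w0 + (\<Sum>l<n t. S (Suc l)) - t"
      proof (intro diff_mono add_left_mono sum_mono2)
        have "n (real i * h) \<le> n t" using h t i by (intro mono_onD[OF n(1)]) auto
        then show "{..<n (real i * h)} \<subseteq> {..<n t}" by auto
        show "t \<le> (real i + 1) * h" using i by simp
      qed (simp_all add: S)
      also have "\<dots> \<le> workload n w0 S (\<lambda>_. \<infinity>) t" using t by (intro workload_ge) simp
      finally show False using t by simp
    qed
    then show "ereal (Suc ?k * h) \<le> y" using t by simp
  qed
  moreover have "ereal (?k * h) < ereal (Suc ?k * h)" using h by simp
  ultimately show ?thesis by (rule less_le_trans[rotated])
qed

section \<open>Cell counts of the arrivals, with independent marks\<close>

locale marked_poisson = prob_space M + marks: real_distribution \<mu>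
  for M :: "'a measure" and \<mu> :: "real measure" +
  fixes lam :: "real \<Rightarrow> real" and lamh h :: real and N :: "'a \<Rightarrow> real \<Rightarrow> nat"
    and X :: "nat \<Rightarrow> 'a \<Rightarrow> real"
  assumes poisson: "poisson_process M lam N"
    and lam_borel: "lam \<in> borel_measurable borel"
    and lam_bounds: "\<And>t. 0 \<le> lam t" "\<And>t. lam t \<le> lamh"
    and h_pos: "0 < h"
    and X_rv: "\<And>i. X i \<in> borel_measurable M"
    and X_indep: "indep_set
          (sets (vimage_algebra (space M) (\<lambda>w t. N w t) (Pi\<^sub>M UNIV (\<lambda>_. count_space UNIV))))
          (sets (vimage_algebra (space M) (\<lambda>w i. X i w) (Pi\<^sub>M UNIV (\<lambda>_. borel))))"
    and X_distr: "distr M (Pi\<^sub>M UNIV (\<lambda>_. borel)) (\<lambda>w i. X i w) = Pi\<^sub>M (UNIV :: nat set) (\<lambda>_. \<mu>)"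
begin

definition cell :: "nat \<Rightarrow> 'a \<Rightarrow> nat" where
  "cell j w = N w (real (Suc j) * h) - N w (real j * h)"

definition mean :: "nat \<Rightarrow> real" where
  "mean j = (\<integral>t\<in>{real j * h..real (Suc j) * h}. lam t \<partial>lborel)"

definition cell_weight :: "nat \<Rightarrow> bool \<Rightarrow> real" where
  "cell_weight j c = (if c then mean j * exp (- mean j) else exp (- mean j))"

lemma N_path:
  assumes "w \<in> space M"
  shows "N w 0 = 0" "mono_on {0..} (N w)"
  using poisson assms by (auto simp: poisson_process_def)

lemma N_measurable [measurable]: "(\<lambda>w. N w t) \<in> measurable M (count_space UNIV)"
  using poisson by (auto simp: poisson_process_def)

lemma cell_measurable [measurable]: "cell j \<in> measurable M (count_space UNIV)"
  unfolding cell_def by measurable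

lemma mean_nonneg: "0 \<le> mean j"
  unfolding mean_def set_lebesgue_integral_def by (intro Bochner_Integration.integral_nonneg) (simp add: lam_bounds)

lemma mean_le: "mean j \<le> lamh * h"
proof -
  let ?I = "{real j * h..real (Suc j) * h}"
  have I: "measure lborel ?I = h" using h_pos by (simp add: algebra_simps)
  have "set_integrable lborel ?I (\<lambda>_. lamh)"
    by (intro borel_integrable_atLeastAtMost' continuous_on_const)
  moreover from this have "set_integrable lborel ?I lam"
    by (rule set_integrable_bound) (use lam_borel lam_bounds in \<open>auto simp: set_borel_measurable_def intro: order_trans[OF lam_bounds(2) abs_ge_self]\<close>)
  ultimately have "mean j \<le> (\<integral>t\<in>?I. lamh \<partial>lborel)"
    unfolding mean_def by (intro set_integral_mono) (auto simp: lam_bounds)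
  also have "\<dots> = lamh * h" using I by (simp add: set_lebesgue_integral_def del: of_nat_Suc)
  finally show ?thesis .
qed

lemma prob_cell: "prob {w\<in>space M. cell j w = k} = mean j ^ k / fact k * exp (- mean j)"
proof -
  have "0 \<le> real j * h \<and> real j * h \<le> real (Suc j) * h" using h_pos by (auto intro: mult_right_mono)
  then show ?thesis using poisson unfolding poisson_process_def cell_def mean_def by blast
qed

lemma prob_cell_bool: "prob {w\<in>space M. cell j w = of_bool c} = cell_weight j c"
  by (cases c) (simp_all add: prob_cell cell_weight_def)

lemma weights_cell_weight: "weights cell_weight"
proof -
  have "exp (- mean i) + mean i * exp (- mean i) \<le> 1" for i
  proof -
    have "(1 + mean i) * exp (- mean i) \<le> exp (mean i) * exp (- mean i)"
      by (intro mult_right_mono exp_ge_add_one_self) simp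
    then show ?thesis by (simp add: algebra_simps exp_minus_inverse)
  qed
  then show ?thesis by (simp add: weights_def cell_weight_def mean_nonneg)
qed

text \<open>The right side, the later \<open>q\<close>, is the probability of at least one arrival
  at the maximal rate. It dominates that of exactly one, and gives
  \<open>(1 - q) ^ K = exp (- lamh * (K * h))\<close>, so that \<open>\<beta>\<close> comes out
  exactly.\<close>

lemma cell_weight_True_le: "cell_weight j True \<le> 1 - exp (- lamh * h)"
proof -
  have "cell_weight j True \<le> 1 - exp (- mean j)"
    using weights_cell_weight by (auto simp: weights_def cell_weight_def algebra_simps)
  also have "\<dots> \<le> 1 - exp (- lamh * h)" using mean_le[of j] by simp
  finally show ?thesis .
qed

lemma prob_cell_pos_le: "prob {w\<in>space M. 0 < cell j w} \<le> lamh * h"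
proof -
  have "{w\<in>space M. 0 < cell j w} = space M - {w\<in>space M. cell j w = 0}" by auto
  then have "prob {w\<in>space M. 0 < cell j w} = 1 - exp (- mean j)"
    by (simp add: prob_compl prob_cell)
  also have "\<dots> \<le> mean j" using exp_ge_add_one_self[of "- mean j"] by simp
  finally show ?thesis using mean_le[of j] by simp
qed

lemma one_minus_cell_weight_le: "1 - cell_weight j False - cell_weight j True \<le> (lamh * h)\<^sup>2"
proof -
  have "(1 + mean j) * (1 - mean j) \<le> (1 + mean j) * exp (- mean j)"
    using exp_ge_add_one_self[of "- mean j"] mean_nonneg[of j] by (intro mult_left_mono) auto
  then have "1 - cell_weight j False - cell_weight j True \<le> (mean j)\<^sup>2"
    by (simp add: cell_weight_def algebra_simps power2_eq_square)
  also have "\<dots> \<le> (lamh * h)\<^sup>2" using mean_le mean_nonneg by (intro power_mono) auto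
  finally show ?thesis .
qed

lemma prob_cell_multiple_le: "prob {w\<in>space M. 1 < cell j w} \<le> (lamh * h)\<^sup>2"
proof -
  have "{w\<in>space M. 1 < cell j w} = space M - ({w\<in>space M. cell j w = 0} \<union> {w\<in>space M. cell j w = 1})" by auto
  moreover have "prob ({w\<in>space M. cell j w = 0} \<union> {w\<in>space M. cell j w = 1}) = cell_weight j False + cell_weight j True"
    by (subst finite_measure_Union) (auto simp: prob_cell cell_weight_def)
  ultimately have "prob {w\<in>space M. 1 < cell j w} = 1 - cell_weight j False - cell_weight j True"
    by (simp add: prob_compl)
  then show ?thesis using one_minus_cell_weight_le[of j] by simp
qed

definition pattern :: "bool list \<Rightarrow> 'a set" where
  "pattern cs = {w\<in>space M. \<forall>j<length cs. cell j w = of_bool (cs ! j)}"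

lemma pattern_sets [measurable]: "pattern cs \<in> events"
  unfolding pattern_def by measurable

lemma prob_pattern: "prob (pattern cs) = (\<Prod>j<length cs. cell_weight j (cs ! j))"
proof (cases "cs = []")
  case True
  then show ?thesis by (simp add: pattern_def prob_space)
next
  case False
  have ts: "0 \<le> real 0 * h \<and> (\<forall>i<length cs. real i * h \<le> real (Suc i) * h)"
    using h_pos by (auto intro: mult_right_mono)
  have "indep_vars (\<lambda>_. count_space UNIV) (\<lambda>i w. N w (ts (Suc i)) - N w (ts i)) {..<n}"
    if "0 \<le> ts 0 \<and> (\<forall>i<n. ts i \<le> ts (Suc i))" for ts n
    using poisson that unfolding poisson_process_def by simp
  from this[OF ts] have "indep_vars (\<lambda>_. count_space UNIV) cell {..<length cs}"
    by (simp only: cell_def[abs_def])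
  then have "prob (\<Inter>i\<in>{..<length cs}. cell i -` {of_bool (cs ! i)} \<inter> space M) =
      (\<Prod>i<length cs. prob (cell i -` {of_bool (cs ! i)} \<inter> space M))"
    using False by (intro indep_varsD_finite[where I = "{..<length cs}"]) auto
  also have "(\<Inter>i\<in>{..<length cs}. cell i -` {of_bool (cs ! i)} \<inter> space M) = pattern cs"
    using False by (auto simp: pattern_def)
  also have "(\<Prod>i<length cs. prob (cell i -` {of_bool (cs ! i)} \<inter> space M)) = (\<Prod>j<length cs. cell_weight j (cs ! j))"
    by (intro prod.cong refl) (simp add: prob_cell_bool[symmetric] vimage_def Int_def conj_commute)
  finally show ?thesis .
qed

lemma pattern_vimage:
  "pattern cs \<in> sets (vimage_algebra (space M) (\<lambda>w t. N w t) (Pi\<^sub>M UNIV (\<lambda>_. count_space UNIV)))"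
proof -
  let ?P = "Pi\<^sub>M (UNIV :: real set) (\<lambda>_. count_space (UNIV :: nat set))"
  let ?A = "{p\<in>space ?P. \<forall>j<length cs. p (real (Suc j) * h) - p (real j * h) = of_bool (cs ! j)}"
  have "?A \<in> sets ?P" by measurable
  then have "(\<lambda>w t. N w t) -` ?A \<inter> space M \<in> sets (vimage_algebra (space M) (\<lambda>w t. N w t) ?P)"
    by (rule in_vimage_algebra)
  also have "(\<lambda>w t. N w t) -` ?A \<inter> space M = pattern cs"
    by (auto simp: pattern_def cell_def space_PiM)
  finally show ?thesis .
qed

lemma prob_pattern_marks:
  assumes R: "{\<omega>\<in>space (Pi\<^sub>M UNIV (\<lambda>_. \<mu>)). R \<omega>} \<in> sets (Pi\<^sub>M UNIV (\<lambda>_. \<mu>))"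
  shows "pattern cs \<inter> {w. R (\<lambda>i. X i w)} \<in> events" (is ?A)
    and "prob (pattern cs \<inter> {w. R (\<lambda>i. X i w)}) =
      (\<Prod>j<length cs. cell_weight j (cs ! j)) * measure (Pi\<^sub>M UNIV (\<lambda>_. \<mu>)) {\<omega>\<in>space (Pi\<^sub>M UNIV (\<lambda>_. \<mu>)). R \<omega>}" (is ?B)
proof -
  let ?P = "Pi\<^sub>M (UNIV :: nat set) (\<lambda>_. borel :: real measure)"
  have sets_eq: "sets (Pi\<^sub>M UNIV (\<lambda>_. \<mu>)) = sets ?P" by (intro sets_PiM_cong) auto
  have sp: "space (Pi\<^sub>M (UNIV :: nat set) (\<lambda>_. \<mu>)) = UNIV" "space ?P = UNIV" by (auto simp: space_PiM)
  have R': "{\<omega>. R \<omega>} \<in> sets ?P" using R by (simp add: sets_eq sp)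
  have Xm: "(\<lambda>w i. X i w) \<in> measurable M ?P"
    by (rule measurable_PiM_single') (auto simp: X_rv)
  have vm: "(\<lambda>w i. X i w) -` {\<omega>. R \<omega>} \<inter> space M \<in> sets (vimage_algebra (space M) (\<lambda>w i. X i w) ?P)"
    using R' by (rule in_vimage_algebra)
  have ev: "(\<lambda>w i. X i w) -` {\<omega>. R \<omega>} \<inter> space M \<in> events"
    using Xm R' by (rule measurable_sets)
  have eq: "pattern cs \<inter> {w. R (\<lambda>i. X i w)} = pattern cs \<inter> ((\<lambda>w i. X i w) -` {\<omega>. R \<omega>} \<inter> space M)"
    by (auto simp: pattern_def)
  show ?A unfolding eq using ev by auto
  have "prob ((\<lambda>w i. X i w) -` {\<omega>. R \<omega>} \<inter> space M) = measure (distr M ?P (\<lambda>w i. X i w)) {\<omega>. R \<omega>}"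
    using Xm R' by (simp add: measure_distr)
  also have "\<dots> = measure (Pi\<^sub>M UNIV (\<lambda>_. \<mu>)) {\<omega>. R \<omega>}" by (simp only: X_distr)
  finally show ?B
    unfolding eq indep_setD[OF X_indep pattern_vimage vm] by (simp add: prob_pattern sp)
qed

end

section \<open>Reduction of the queues to slotted time\<close>

locale slotted_model = marked_poisson M \<mu> lam lamh h N X + Q: slotted_queue \<mu> h "1 - exp (- lamh * h)" K
  for M :: "'a measure" and \<mu> :: "real measure" and lam lamh h N X K +
  assumes X_nonneg: "AE w in M. \<forall>i. 0 \<le> X i w"
begin

lemma cell_Suc:
  assumes "w \<in> space M"
  shows "N w (real (Suc j) * h) = N w (real j * h) + cell j w"
proof -
  have "N w (real j * h) \<le> N w (real (Suc j) * h)"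
    using h_pos by (intro mono_onD[OF N_path(2)[OF assms]]) auto
  then show ?thesis by (simp add: cell_def)
qed

lemma pattern_Suc:
  assumes "w \<in> pattern cs" "j < length cs"
  shows "N w (real (Suc j) * h) = N w (real j * h) + of_bool (cs ! j)"
  using assms cell_Suc[of w j] by (auto simp: pattern_def)

lemma pattern_disjoint:
  assumes "length cs = length cs'" "w \<in> pattern cs" "w \<in> pattern cs'"
  shows "cs = cs'"
proof (rule nth_equalityI[OF assms(1)])
  fix i assume "i < length cs"
  then have "cell i w = of_bool (cs ! i)" "cell i w = of_bool (cs' ! i)"
    using assms by (auto simp: pattern_def)
  then show "cs ! i = cs' ! i" by (simp add: of_bool_eq_iff)
qed

lemma prob_survives_sum_le:
  "(\<Sum>cs | length cs = n. prob (pattern cs \<inter> {w. survives (\<lambda>n x. K dvd n \<longrightarrow> 0 < x) (\<lambda>x. max x 0) h cs x (\<lambda>i. X i w)}))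
    \<le> Q.obs.val n Q.bern x"
proof -
  have "(\<Sum>cs | length cs = n. prob (pattern cs \<inter> {w. survives (\<lambda>n x. K dvd n \<longrightarrow> 0 < x) (\<lambda>x. max x 0) h cs x (\<lambda>i. X i w)}))
    = Q.obs.val n cell_weight x"
    unfolding Q.obs.sum_weighted_survives[symmetric]
    by (intro sum.cong refl) (simp add: prob_pattern_marks(2)[OF Q.obs.survives_sets])
  also have "\<dots> \<le> Q.obs.val n Q.bern x"
    by (rule Q.obs.val_le_val[OF weights_cell_weight Q.q cell_weight_True_le])
  finally show ?thesis .
qed

text \<open>Patterns of length \<open>k\<close> are disjoint, and on each of them survival forces
  the true busy period beyond \<open>k * h\<close>, so with exact cell weights the bound is
  \<open>prob ?E\<close>. Passing from these weights to \<open>bern\<close> costs the bound on two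
  arrivals once per slot. Mark 0 is the initial service, split off by
  \<open>measure_mark_shift\<close>.\<close>

lemma expected_busy_le:
  assumes const: "\<And>t. lam t = lamh"
    and ev: "{w\<in>space M. ereal (real k * h) < busy_period (workload (N w) (X 0 w) (\<lambda>i. X i w) (\<lambda>_. \<infinity>))} \<in> events" (is "?E \<in> _")
  shows "(\<integral>s. Q.busy.val k Q.bern (s - h) \<partial>\<mu>) \<le> prob ?E + k * (lamh * h)\<^sup>2"
proof -
  let ?surv = "survives (\<lambda>n x. 0 < x) (\<lambda>x. x) h"
  let ?m = "\<lambda>R. measure (Pi\<^sub>M UNIV (\<lambda>_. \<mu>)) {\<omega>\<in>space (Pi\<^sub>M UNIV (\<lambda>_. \<mu>)). R \<omega>}"
  have meas: "Measurable.pred (borel \<Otimes>\<^sub>M Pi\<^sub>M UNIV (\<lambda>_. \<mu>)) (\<lambda>(s, \<omega>). ?surv cs (s - h) \<omega>)" for cs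
    using Q.busy.survives_add_measurable[of cs 0] by simp
  have mean: "mean j = lamh * h" for j
    unfolding mean_def const set_lebesgue_integral_def using h_pos by (simp add: algebra_simps)
  have "(\<integral>s. Q.busy.val k Q.bern (s - h) \<partial>\<mu>) \<le> (\<integral>s. Q.busy.val k cell_weight (s - h) + k * (lamh * h)\<^sup>2 \<partial>\<mu>)"
  proof (intro integral_mono Bochner_Integration.integrable_add)
    show "integrable \<mu> (\<lambda>s. Q.busy.val k Q.bern (s - h))" "integrable \<mu> (\<lambda>s. Q.busy.val k cell_weight (s - h))"
      using Q.busy.val_integrable[OF Q.weights_bern, of k 0] Q.busy.val_integrable[OF weights_cell_weight, of k 0] by simp_all
    show "Q.busy.val k Q.bern (s - h) \<le> Q.busy.val k cell_weight (s - h) + k * (lamh * h)\<^sup>2" for s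
    proof (rule Q.busy.val_le_val_add[OF weights_cell_weight Q.q])
      show "cell_weight i False = 1 - (1 - exp (- lamh * h))" for i by (simp add: cell_weight_def mean)
      then show "1 - exp (- lamh * h) - (lamh * h)\<^sup>2 \<le> cell_weight i True" for i
        using one_minus_cell_weight_le[of i] by (simp add: algebra_simps)
    qed simp
  qed simp
  also have "\<dots> = (\<integral>s. Q.busy.val k cell_weight (s - h) \<partial>\<mu>) + k * (lamh * h)\<^sup>2"
    using Q.busy.val_integrable[OF weights_cell_weight, of k 0] marks.prob_space
    by (subst Bochner_Integration.integral_add) simp_all
  also have "(\<integral>s. Q.busy.val k cell_weight (s - h) \<partial>\<mu>) =
    (\<Sum>cs | length cs = k. prob (pattern cs \<inter> {w. ?surv cs (X 0 w - h) (\<lambda>i. X (Suc i) w)}))"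
  proof -
    note shift = Q.busy.measure_mark_shift[OF meas]
    have int: "integrable \<mu> (\<lambda>s. ?m (\<lambda>\<omega>. ?surv cs (s - h) \<omega>))" for cs
    proof (rule marks.integrable_const_bound[where B = 1])
      have "(\<lambda>s. ?m (\<lambda>\<omega>. ?surv cs (s - h) \<omega>)) \<in> borel_measurable borel"
        using meas[of cs] by measurable
      then show "(\<lambda>s. ?m (\<lambda>\<omega>. ?surv cs (s - h) \<omega>)) \<in> borel_measurable \<mu>" by simp
    qed simp
    have "(\<integral>s. Q.busy.val k cell_weight (s - h) \<partial>\<mu>) =
      (\<Sum>cs | length cs = k. (\<Prod>j<k. cell_weight j (cs ! j)) * (\<integral>s. ?m (\<lambda>\<omega>. ?surv cs (s - h) \<omega>) \<partial>\<mu>))"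
      unfolding Q.busy.sum_weighted_survives[symmetric]
      by (subst Bochner_Integration.integral_sum) (auto intro!: int)
    also have "\<dots> = (\<Sum>cs | length cs = k. prob (pattern cs \<inter> {w. ?surv cs (X 0 w - h) (\<lambda>i. X (Suc i) w)}))"
    proof (intro sum.cong refl)
      fix cs :: "bool list" assume "cs \<in> {cs. length cs = k}"
      then show "(\<Prod>j<k. cell_weight j (cs ! j)) * (\<integral>s. ?m (\<lambda>\<omega>. ?surv cs (s - h) \<omega>) \<partial>\<mu>) =
         prob (pattern cs \<inter> {w. ?surv cs (X 0 w - h) (\<lambda>i. X (Suc i) w)})"
        using prob_pattern_marks(2)[OF shift(1), of cs cs] shift(2)[of cs] by simp
    qed
    finally show ?thesis .
  qed
  also have "\<dots> = prob (\<Union>cs\<in>{cs. length cs = k}. pattern cs \<inter> {w. ?surv cs (X 0 w - h) (\<lambda>i. X (Suc i) w)})"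
  proof (rule finite_measure_finite_Union[symmetric])
    show "(\<lambda>cs. pattern cs \<inter> {w. ?surv cs (X 0 w - h) (\<lambda>i. X (Suc i) w)}) ` {cs. length cs = k} \<subseteq> events"
    proof safe
      fix cs :: "bool list"
      show "pattern cs \<inter> {w. ?surv cs (X 0 w - h) (\<lambda>i. X (Suc i) w)} \<in> events"
        using prob_pattern_marks(1)[OF Q.busy.measure_mark_shift(1)[OF meas], of cs] .
    qed
    show "disjoint_family_on (\<lambda>cs. pattern cs \<inter> {w. ?surv cs (X 0 w - h) (\<lambda>i. X (Suc i) w)}) {cs. length cs = k}"
      unfolding disjoint_family_on_def using pattern_disjoint by blast
  qed (rule finite_lists_length)
  also have "\<dots> \<le> prob ?E"
  proof (rule finite_measure_mono_AE[OF _ ev])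
    show "AE w in M. w \<in> (\<Union>cs\<in>{cs. length cs = k}. pattern cs \<inter> {w. ?surv cs (X 0 w - h) (\<lambda>i. X (Suc i) w)}) \<longrightarrow> w \<in> ?E"
      using X_nonneg
    proof (eventually_elim, intro impI)
      fix w assume X: "\<forall>i. 0 \<le> X i w"
        and "w \<in> (\<Union>cs\<in>{cs. length cs = k}. pattern cs \<inter> {w. ?surv cs (X 0 w - h) (\<lambda>i. X (Suc i) w)})"
      then obtain cs where cs: "length cs = k" "w \<in> pattern cs" "?surv cs (X 0 w - h) (\<lambda>i. X (Suc i) w)" by auto
      then have w: "w \<in> space M" by (simp add: pattern_def)
      have "ereal (length cs * h) < busy_period (workload (N w) (X 0 w) (\<lambda>i. X i w) (\<lambda>_. \<infinity>))"
        using X cs pattern_Suc[OF cs(2)] by (intro busy_period_greater N_path w h_pos) auto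
      then show "w \<in> ?E" using cs w by simp
    qed
  qed
  finally show ?thesis by simp
qed

text \<open>The event is covered by three: an arrival in the last cell before one of the first
  \<open>m\<close> multiples (\<open>U1\<close>), a cell with at least two arrivals
  (\<open>U2\<close>), survival of the chain (\<open>U3\<close>). Measurability is established for
  the cover.\<close>

lemma xi_tail_le:
  assumes S: "\<And>w i. S w (Suc i) = X i w" and K: "2 \<le> K" and m: "1 \<le> m" "real m * (real K * h) \<le> u"
  shows "prob {w\<in>space M. ereal u < xi_time (real K * h) (workload (N w) 0 (S w) (Y w))} \<le>
    Q.obs.val (m * K - 1) Q.bern 0 + real (m * K) * (lamh * h)\<^sup>2 + real m * (lamh * h)"
proof -
  \<comment> \<open>The chain is observed one slot before each multiple: workload minus
    \<open>h\<close> is what remains at the multiple if the last cell is empty, which holds off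
    \<open>U1\<close>. With \<open>m * K - 1\<close> slots in all, these are the boundaries with a
    remaining number divisible by \<open>K\<close>.\<close>
  let ?n = "m * K - 1"
  let ?surv = "survives (\<lambda>n x. K dvd n \<longrightarrow> 0 < x) (\<lambda>x. max x 0) h"
  define U1 where "U1 = (\<Union>l\<in>{1..m}. {w\<in>space M. 0 < cell (l * K - 1) w})"
  define U2 where "U2 = (\<Union>j<?n. {w\<in>space M. 1 < cell j w})"
  define U3 where "U3 = (\<Union>cs\<in>{cs. length cs = ?n}. pattern cs \<inter> {w. ?surv cs 0 (\<lambda>i. X i w)})"
  have lamh: "0 \<le> lamh" using lam_bounds[of 0] by simp
  have U1: "prob U1 \<le> real m * (lamh * h)" "U1 \<in> events"
  proof -
    have "prob U1 \<le> (\<Sum>l\<in>{1..m}. prob {w\<in>space M. 0 < cell (l * K - 1) w})"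
      unfolding U1_def by (rule finite_measure_subadditive_finite) auto
    also have "\<dots> \<le> real m * (lamh * h)"
      using sum_bounded_above[of "{1..m}", OF prob_cell_pos_le] by simp
    finally show "prob U1 \<le> real m * (lamh * h)" .
    show "U1 \<in> events" unfolding U1_def by measurable
  qed
  have U2: "prob U2 \<le> real (m * K) * (lamh * h)\<^sup>2" "U2 \<in> events"
  proof -
    have "prob U2 \<le> (\<Sum>j<?n. prob {w\<in>space M. 1 < cell j w})"
      unfolding U2_def by (rule finite_measure_subadditive_finite) auto
    also have "\<dots> \<le> real ?n * (lamh * h)\<^sup>2"
      using sum_bounded_above[of "{..<?n}", OF prob_cell_multiple_le] by simp
    also have "\<dots> \<le> real (m * K) * (lamh * h)\<^sup>2" by (intro mult_right_mono of_nat_mono) auto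
    finally show "prob U2 \<le> real (m * K) * (lamh * h)\<^sup>2" .
    show "U2 \<in> events" unfolding U2_def by measurable
  qed
  have ev3: "pattern cs \<inter> {w. ?surv cs 0 (\<lambda>i. X i w)} \<in> events" for cs
    by (rule prob_pattern_marks(1)[OF Q.obs.survives_sets])
  have U3: "prob U3 \<le> Q.obs.val ?n Q.bern 0" "U3 \<in> events"
  proof -
    have "prob U3 \<le> (\<Sum>cs | length cs = ?n. prob (pattern cs \<inter> {w. ?surv cs 0 (\<lambda>i. X i w)}))"
      unfolding U3_def by (rule finite_measure_subadditive_finite) (use ev3 in \<open>auto simp: finite_lists_length\<close>)
    also have "\<dots> \<le> Q.obs.val ?n Q.bern 0" by (rule prob_survives_sum_le)
    finally show "prob U3 \<le> Q.obs.val ?n Q.bern 0" .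
    show "U3 \<in> events" unfolding U3_def by (intro sets.finite_UN finite_lists_length ev3)
  qed
  have "prob {w\<in>space M. ereal u < xi_time (real K * h) (workload (N w) 0 (S w) (Y w))} \<le> prob (U3 \<union> (U2 \<union> U1))"
  proof (rule finite_measure_mono_AE)
    show "AE w in M. w \<in> {w\<in>space M. ereal u < xi_time (real K * h) (workload (N w) 0 (S w) (Y w))} \<longrightarrow> w \<in> U3 \<union> (U2 \<union> U1)"
      using X_nonneg
    proof (eventually_elim, intro impI)
      fix w assume X: "\<forall>i. 0 \<le> X i w"
        and w': "w \<in> {w\<in>space M. ereal u < xi_time (real K * h) (workload (N w) 0 (S w) (Y w))}"
      then have w: "w \<in> space M" and xi: "ereal u < xi_time (real K * h) (workload (N w) 0 (S w) (Y w))" by auto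
      let ?W = "workload (N w) 0 (S w) (Y w)"
      show "w \<in> U3 \<union> (U2 \<union> U1)"
      proof (rule ccontr)
        assume "w \<notin> U3 \<union> (U2 \<union> U1)"
        then have nU: "w \<notin> U3" and n1: "\<And>l. 1 \<le> l \<Longrightarrow> l \<le> m \<Longrightarrow> cell (l * K - 1) w = 0"
          and n2: "\<And>j. j < ?n \<Longrightarrow> cell j w \<le> 1"
          using w by (auto simp: U1_def U2_def not_less)
        define cs where "cs = map (\<lambda>j. cell j w = 1) [0..<?n]"
        have len: "length cs = ?n" by (simp add: cs_def)
        have "cell j w = of_bool (cs ! j)" if "j < ?n" for j
          using n2[OF that] that by (auto simp: cs_def)
        then have pat: "w \<in> pattern cs" using w len by (simp add: pattern_def)
        have busy: "h < ?W (real j * h)" if j: "j \<le> length cs" "K dvd length cs - j" for j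
        proof -
          obtain d where d: "?n - j = K * d" using j(2) unfolding len by (auto elim: dvdE)
          define l where "l = m - d"
          have mK: "1 \<le> m * K" using m K by simp
          have "Suc j + x = y" if "1 \<le> y" "y - 1 - j = x" "j \<le> y - 1" for x y
            using that by simp
          from this[OF mK d j(1)[unfolded len]] have j1: "Suc j + K * d = m * K" .
          then have "K * d < m * K" by linarith
          then have "K * d < K * m" by (simp only: mult.commute)
          then have "d < m" by simp
          then have l: "1 \<le> l" "l \<le> m" by (auto simp: l_def)
          have jl: "Suc j = l * K"
          proof -
            have "m = l + d" using \<open>d < m\<close> by (simp add: l_def)
            then have "m * K = l * K + K * d" by (simp add: algebra_simps)
            then show ?thesis using j1 by linarith
          qed
          have "real K * h * real l \<le> u"
          proof -
            have "real K * h * real l \<le> real K * h * real m" using l h_pos by (intro mult_left_mono) auto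
            then show ?thesis using m by (simp add: mult.commute)
          qed
          have "?W (real K * h * real l) \<noteq> 0"
          proof
            assume "?W (real K * h * real l) = 0"
            then have "xi_time (real K * h) ?W \<le> ereal (real K * h * real l)"
              unfolding xi_time_def using l by (intro Inf_lower) auto
            also have "\<dots> \<le> ereal u" using \<open>real K * h * real l \<le> u\<close> by simp
            finally show False using xi by simp
          qed
          moreover have "real K * h * real l = real (Suc j) * h" unfolding jl by simp
          moreover have "0 \<le> ?W t" for t by (simp add: workload_def)
          ultimately have pos: "0 < ?W (real (Suc j) * h)" by (metis less_eq_real_def)
          have "N w (real (Suc j) * h) = N w (real j * h)"
            using cell_Suc[OF w, of j] n1[OF l] jl by (metis add_0_right diff_Suc_1)
          moreover have "?W (real (Suc j) * h) \<le> max (?W (real j * h) - (real (Suc j) * h - real j * h)) 0 +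
              (\<Sum>i\<in>{N w (real j * h)..<N w (real (Suc j) * h)}. S w (Suc i))"
            using h_pos X S by (intro workload_increment_le N_path w) auto
          ultimately show ?thesis using pos by (simp add: algebra_simps)
        qed
        have "?surv cs 0 (\<lambda>i. S w (Suc (N w (real 0 * h) + i)))"
        proof (rule survives_obs[where Y = "Y w"])
          show "h < ?W (real (0 + i) * h)" if "i \<le> length cs" "K dvd length cs - i" for i
            using busy[OF that] by simp
          show "N w (real (Suc (0 + i)) * h) = N w (real (0 + i) * h) + of_bool (cs ! i)" if "i < length cs" for i
            using pattern_Suc[OF pat that] by simp
          show "?W (real 0 * h) - h \<le> 0"
            using h_pos N_path(1)[OF w] by (simp add: workload_def arr_time_def)
        qed (use X S h_pos N_path(2)[OF w] in auto)
        then have "w \<in> U3" using pat len w N_path(1)[OF w] S by (auto simp: U3_def)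
        then show False using nU by simp
      qed
    qed
  qed (use U1 U2 U3 in auto)
  also have "\<dots> \<le> prob U3 + (prob U2 + prob U1)"
    using measure_Un_le[of U3 M "U2 \<union> U1"] measure_Un_le[of U2 M U1] U1(2) U2(2) U3(2) by simp
  finally show ?thesis using U1(1) U2(1) U3(1) by simp
qed

end

text \<open>With \<open>u\<close> fixed, \<open>K\<close> tends to infinity and the errors, of order
  \<open>1 / K\<close> with a constant depending on \<open>u\<close>, vanish. \<open>D\<close> and
  \<open>\<zeta>\<close> must not depend on \<open>K\<close>, hence the offset
  \<open>\<kappa> + 1\<close> instead of \<open>\<kappa> + h\<close>.\<close>

lemma xi_tail_le_profile:
  fixes \<kappa> lamh vmin u :: real
  assumes model: "\<And>K. 0 < K \<Longrightarrow> slotted_model M \<mu> lam lamh (\<kappa> / real K) N X K"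
    and model': "\<And>K. 0 < K \<Longrightarrow> slotted_model M' \<mu> (\<lambda>_. lamh) lamh (\<kappa> / real K) N' X' K"
    and \<kappa>: "0 < \<kappa>" and S: "\<And>w i. S w (Suc i) = X i w"
    and \<phi>: "\<And>v. vmin \<le> v \<Longrightarrow> {w\<in>space M'. ereal v < busy_period (workload (N' w) (X' 0 w) (\<lambda>i. X' i w) (\<lambda>_. \<infinity>))} \<in> sets M'"
    and \<zeta>: "real_distribution \<zeta>" "AE z in \<zeta>. \<kappa> + 1 \<le> z"
    and \<zeta>_small: "\<And>v. v < vmin \<Longrightarrow> measure \<zeta> {v + (\<kappa> + 1)<..} = 1"
    and \<zeta>_tail: "\<And>v. vmin \<le> v \<Longrightarrow> measure M' {w\<in>space M'. ereal v < busy_period (workload (N' w) (X' 0 w) (\<lambda>i. X' i w) (\<lambda>_. \<infinity>))}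
       \<le> measure \<zeta> {v + (\<kappa> + 1)<..}"
    and D: "antimono D" "\<And>v. 0 \<le> D v" "\<And>v. D v \<le> 1" "\<And>v. v < 0 \<Longrightarrow> D v = 1"
    and super: "\<And>v. 0 \<le> v \<Longrightarrow> (1 - exp (- \<kappa> * lamh)) * (\<integral>z. D (v - z) \<partial>\<zeta>) \<le> D v"
    and u: "\<kappa> \<le> u"
  shows "measure M {w\<in>space M. ereal u < xi_time \<kappa> (workload (N w) 0 (S w) (Y w))} \<le> D (u - (\<kappa> + 1))"
proof -
  let ?\<beta> = "1 - exp (- \<kappa> * lamh)" and ?P = "measure M {w\<in>space M. ereal u < xi_time \<kappa> (workload (N w) 0 (S w) (Y w))}"
  interpret Z: real_distribution \<zeta> by (rule \<zeta>)
  define m where "m = nat \<lfloor>u / \<kappa>\<rfloor>"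
  have m: "1 \<le> m" "real m * \<kappa> \<le> u" "u < (real m + 1) * \<kappa>"
  proof -
    have "1 \<le> u / \<kappa>" using u \<kappa> by simp
    then have "1 \<le> \<lfloor>u / \<kappa>\<rfloor>" by linarith
    then show "1 \<le> m" unfolding m_def by linarith
    have "real m = of_int \<lfloor>u / \<kappa>\<rfloor>" using \<open>1 \<le> \<lfloor>u / \<kappa>\<rfloor>\<close> by (simp add: m_def)
    then have "real m \<le> u / \<kappa>" "u / \<kappa> < real m + 1" by linarith+
    then show "real m * \<kappa> \<le> u" "u < (real m + 1) * \<kappa>"
      using \<kappa> by (simp_all add: pos_le_divide_eq pos_divide_less_eq)
  qed
  define C where "C = real m * (lamh * \<kappa>)\<^sup>2 / (1 - ?\<beta>) + real m * (lamh * \<kappa>)\<^sup>2 + real m * (lamh * \<kappa>)"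
  have bound: "?P \<le> D (u - (\<kappa> + 1)) + C / real K" if K: "2 \<le> K" "\<kappa> \<le> real K" for K
  proof -
    define h where "h = \<kappa> / real K"
    have h: "0 < h" "h \<le> 1" "real K * h = \<kappa>" using K \<kappa> by (auto simp: h_def)
    interpret A: slotted_model M \<mu> lam lamh h N X K unfolding h_def by (rule model) (use K in simp)
    interpret B: slotted_model M' \<mu> "\<lambda>_. lamh" lamh h N' X' K unfolding h_def by (rule model') (use K in simp)
    let ?n = "m * K - 1"
    define err where "err = real (m * K) * (lamh * h)\<^sup>2"
    have err: "0 \<le> err" "err = real m * (lamh * \<kappa>)\<^sup>2 / real K"
      using K by (simp add: err_def, simp add: err_def h_def power2_eq_square field_simps)
    have "A.Q.f ?n 0 \<le> D (real ?n * h) + err / (1 - ?\<beta>)"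
    proof (rule A.Q.f_zero_le[where \<zeta> = \<zeta> and nmax = ?n])
      show "AE z in \<zeta>. real K * h + h \<le> z" using \<zeta>(2) by eventually_elim (use h in simp)
      have "exp (- lamh * h) ^ K = exp (- \<kappa> * lamh)"
        using h(3) by (simp add: exp_of_nat_mult[symmetric] mult.assoc mult.left_commute mult.commute)
      then show "1 - (1 - (1 - exp (- lamh * h))) ^ K \<le> ?\<beta>" by simp
      show "(\<integral>s. A.Q.b k (s - h) \<partial>\<mu>) \<le> measure \<zeta> {real k * h + (real K * h + h)<..} + err" if k: "k \<le> ?n" for k
      proof -
        have mono: "measure \<zeta> {real k * h + (\<kappa> + 1)<..} \<le> measure \<zeta> {real k * h + (real K * h + h)<..}"
          using h by (intro Z.finite_measure_mono) auto
        \<comment> \<open>Below \<open>vmin\<close> the busy-period event is not known to be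
          measurable; there the tail of \<open>\<zeta>\<close> is 1 and the trivial bound
          suffices.\<close>
        show ?thesis
        proof (cases "vmin \<le> real k * h")
          case True
          have "(\<integral>s. A.Q.b k (s - h) \<partial>\<mu>) \<le> measure M' {w\<in>space M'. ereal (real k * h) < busy_period (workload (N' w) (X' 0 w) (\<lambda>i. X' i w) (\<lambda>_. \<infinity>))} + k * (lamh * h)\<^sup>2"
            by (rule B.expected_busy_le[OF refl \<phi>[OF True]])
          also have "real k * (lamh * h)\<^sup>2 \<le> err"
            unfolding err_def using k by (intro mult_right_mono of_nat_mono) auto
          finally show ?thesis using \<zeta>_tail[OF True] mono by simp
        next
          case False
          have "(\<integral>s. A.Q.b k (s - h) \<partial>\<mu>) \<le> (\<integral>s. 1 \<partial>\<mu>)"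
            using A.Q.busy.val_integrable[OF A.Q.weights_bern, of k 0]
            by (intro integral_mono) (simp_all add: A.Q.busy.val_props[OF A.Q.weights_bern])
          then have "(\<integral>s. A.Q.b k (s - h) \<partial>\<mu>) \<le> 1" using A.marks.prob_space by simp
          moreover have "measure \<zeta> {real k * h + (\<kappa> + 1)<..} = 1" using False by (intro \<zeta>_small) simp
          ultimately show ?thesis using mono err(1) by linarith
        qed
      qed
    qed (use D super \<zeta> err in auto)
    moreover have "?P \<le> A.Q.f ?n 0 + err + real m * (lamh * h)"
    proof -
      have "real m * (real K * h) \<le> u" using m h by simp
      from A.xi_tail_le[OF S K(1) m(1) this, of Y] show ?thesis unfolding h(3) err_def .
    qed
    \<comment> \<open>\<open>?n * h = m * \<kappa> - h > u - \<kappa> - h\<close> with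
      \<open>h \<le> 1\<close>, whence the shift by \<open>\<kappa> + 1\<close>.\<close>
    moreover have "D (real ?n * h) \<le> D (u - (\<kappa> + 1))"
    proof (rule antimonoD[OF D(1)])
      have "real ?n = real m * real K - 1" using m K by (simp add: of_nat_diff Suc_le_eq)
      then have "real ?n * h = real m * (real K * h) - h" by (simp only: left_diff_distrib mult.assoc mult_1)
      then have "real ?n * h = real m * \<kappa> - h" by (simp only: h(3))
      then show "u - (\<kappa> + 1) \<le> real ?n * h" using m(3) h(2) by (simp add: algebra_simps)
    qed
    moreover have "err / (1 - ?\<beta>) + err + real m * (lamh * h) = C / real K"
      unfolding err(2) C_def h_def by (simp add: add_divide_distrib)
    ultimately show ?thesis by linarith
  qed
  have "(\<lambda>K. D (u - (\<kappa> + 1)) + C / real K) \<longlonglongrightarrow> D (u - (\<kappa> + 1)) + 0"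
    by (intro tendsto_intros lim_const_over_n)
  then have "(\<lambda>K. D (u - (\<kappa> + 1)) + C / real K) \<longlonglongrightarrow> D (u - (\<kappa> + 1))" by simp
  then show ?thesis
  proof (rule LIMSEQ_le_const)
    show "\<exists>K0. \<forall>K\<ge>K0. ?P \<le> D (u - (\<kappa> + 1)) + C / real K"
    proof (intro exI allI impI)
      fix K assume "max 2 (nat \<lceil>\<kappa>\<rceil>) \<le> K"
      then show "?P \<le> D (u - (\<kappa> + 1)) + C / real K" by (intro bound) linarith+
    qed
  qed
qed

section \<open>Independence, distributions, and a real-valued busy period\<close>

lemma (in prob_space) indep_vars_Suc:
  assumes "indep_vars M' X (UNIV :: nat set)"
  shows "indep_vars (\<lambda>i. M' (Suc i)) (\<lambda>i. X (Suc i)) UNIV"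
proof -
  let ?F = "\<lambda>i. {X i -` A \<inter> space M |A. A \<in> sets (M' i)}"
  have rv: "\<And>i. random_variable (M' i) (X i)" and ind: "indep_sets ?F UNIV"
    using assms by (auto simp: indep_vars_def2)
  have "indep_sets (\<lambda>i. ?F (Suc i)) UNIV"
  proof (rule indep_setsI)
    show "?F (Suc i) \<subseteq> events" for i using rv by (auto intro: measurable_sets)
    fix A J assume J: "J \<noteq> {}" "J \<subseteq> (UNIV :: nat set)" "finite J" and A: "\<forall>j\<in>J. A j \<in> ?F (Suc j)"
    have "prob (\<Inter>j\<in>Suc ` J. A (j - 1)) = (\<Prod>j\<in>Suc ` J. prob (A (j - 1)))"
      by (rule indep_setsD[OF ind]) (use J A in auto)
    then show "prob (\<Inter>j\<in>J. A j) = (\<Prod>j\<in>J. prob (A j))"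
      by (simp add: prod.reindex)
  qed
  then show ?thesis using rv by (auto simp: indep_vars_def2)
qed

lemma (in prob_space) indep_set_mono:
  assumes "indep_set A B" "A' \<subseteq> A" "B' \<subseteq> B"
  shows "indep_set A' B'"
  using assms unfolding indep_set_def
  by (rule_tac indep_sets_mono_sets) (auto split: bool.split)

lemma (in prob_space) distr_iid_sequence:
  fixes X :: "nat \<Rightarrow> 'a \<Rightarrow> real"
  assumes "indep_vars (\<lambda>_. borel) X UNIV" and "\<And>i. distr M borel (X i) = \<mu>"
  shows "distr M (Pi\<^sub>M UNIV (\<lambda>_. borel)) (\<lambda>w i. X i w) = Pi\<^sub>M UNIV (\<lambda>_. \<mu>)"
proof -
  have "\<And>i. random_variable borel (X i)" using assms(1) by (auto simp: indep_vars_def)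
  with assms show ?thesis
    using indep_vars_iff_distr_eq_PiM[where I = UNIV and M' = "\<lambda>_. borel" and X = X] by (simp add: restrict_UNIV)
qed

lemma interval_measure_eqI:
  assumes "real_distribution \<nu>" "\<And>x. measure \<nu> {..x} = F x"
  shows "interval_measure F = \<nu>"
proof -
  interpret real_distribution \<nu> by fact
  have F: "F = cdf \<nu>" using assms(2) by (auto simp: cdf_def)
  show ?thesis unfolding F
  proof (rule cdf_unique)
    show "real_distribution (interval_measure (cdf \<nu>))"
      by (intro real_distribution_interval_measure cdf_nondecreasing cdf_is_right_cont cdf_lim_at_bot cdf_lim_at_top_prob)
    show "cdf (interval_measure (cdf \<nu>)) = cdf \<nu>"
      by (intro cdf_interval_measure cdf_nondecreasing cdf_is_right_cont cdf_lim_at_bot)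
  qed fact
qed

text \<open>The tails tend to 0, so \<open>\<phi> = \<infinity>\<close> is a null event and a
  real-valued version exists. It is cut off below at \<open>u0\<close> because only levels from
  \<open>u0\<close> on are known to give events.\<close>

lemma (in prob_space) finite_part_exists:
  fixes \<phi> :: "'a \<Rightarrow> ereal" and u0 :: real
  assumes ev: "\<And>v. u0 \<le> v \<Longrightarrow> {w\<in>space M. ereal v < \<phi> w} \<in> events"
    and lim: "((\<lambda>v. prob {w\<in>space M. ereal v < \<phi> w}) \<longlongrightarrow> 0) at_top"
  obtains Z where "Z \<in> borel_measurable M" "\<And>w. u0 \<le> Z w"
    "\<And>v. u0 \<le> v \<Longrightarrow> prob {w\<in>space M. v < Z w} = prob {w\<in>space M. ereal v < \<phi> w}"
proof
  define Z where "Z = (\<lambda>w. if \<phi> w = \<infinity> then u0 else real_of_ereal (max (\<phi> w) (ereal u0)))"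
  define I where "I = (\<Inter>n. {w\<in>space M. ereal (u0 + real n) < \<phi> w})"
  have I_ev: "I \<in> events" unfolding I_def using ev by (intro sets.countable_INT') auto
  have I: "I = {w\<in>space M. \<phi> w = \<infinity>}"
  proof safe
    fix w assume w: "w \<in> I"
    then show "w \<in> space M" by (auto simp: I_def)
    show "\<phi> w = \<infinity>"
    proof (rule ereal_top)
      fix B :: real
      obtain n :: nat where "B - u0 \<le> real n" using real_arch_simple by blast
      then have "ereal B \<le> ereal (u0 + real n)" by simp
      also have "\<dots> \<le> \<phi> w" using w by (auto simp: I_def less_imp_le)
      finally show "ereal B \<le> \<phi> w" .
    qed
  qed (auto simp: I_def)
  have "prob I \<le> 0"
  proof (rule tendsto_lowerbound[OF lim])
    show "\<forall>\<^sub>F v in at_top. prob I \<le> prob {w\<in>space M. ereal v < \<phi> w}"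
      using eventually_ge_at_top[of u0]
    proof eventually_elim
      case (elim v)
      then show ?case by (intro finite_measure_mono ev) (auto simp: I)
    qed
  qed simp
  then have I0: "prob I = 0" by (simp add: measure_le_0_iff)
  have Z: "v < Z w \<longleftrightarrow> ereal v < \<phi> w \<and> \<phi> w \<noteq> \<infinity>" if "u0 \<le> v" for v w
  proof (cases "\<phi> w")
    case (real r)
    then show ?thesis using that by (auto simp: Z_def max_def)
  qed (use that in \<open>auto simp: Z_def max_def\<close>)
  show Z_ge: "u0 \<le> Z w" for w
    by (cases "\<phi> w") (auto simp: Z_def max_def)
  have Z_eq: "{w\<in>space M. v < Z w} = {w\<in>space M. ereal v < \<phi> w} - I" if "u0 \<le> v" for v
    using Z[OF that] by (auto simp: I)
  show "Z \<in> borel_measurable M"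
  proof (subst borel_measurable_iff_greater, intro allI)
    fix v
    show "{w\<in>space M. v < Z w} \<in> events"
    proof (cases "u0 \<le> v")
      case True
      then show ?thesis using ev I_ev by (simp add: Z_eq)
    next
      case False
      then have "v < Z w" for w using Z_ge[of w] by simp
      then have "{w\<in>space M. v < Z w} = space M" by simp
      then show ?thesis by simp
    qed
  qed
  show "prob {w\<in>space M. v < Z w} = prob {w\<in>space M. ereal v < \<phi> w}" if "u0 \<le> v" for v
    unfolding Z_eq[OF that] using I0 I_ev ev[OF that]
    by (subst measure_Diff_null_set) (auto simp: null_sets_def emeasure_eq_measure)
qed

theorem theorem4:
  fixes \<Psi> :: "real \<Rightarrow> ereal \<Rightarrow> real"
    and lam :: "real \<Rightarrow> real" and \<kappa> lamh :: real
    and M :: "'a measure" and N :: "'a \<Rightarrow> real \<Rightarrow> nat"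
    and S :: "nat \<Rightarrow> 'a \<Rightarrow> real" and Y :: "nat \<Rightarrow> 'a \<Rightarrow> ereal"
    and M' :: "'b measure" and N' :: "'b \<Rightarrow> real \<Rightarrow> nat"
    and S' :: "nat \<Rightarrow> 'b \<Rightarrow> real"
  defines "G \<equiv> svc_cdf \<Psi>"
  defines "\<rho> \<equiv> lamh * (\<integral>y. y \<partial>interval_measure G)"
  assumes L: "in_L \<Psi>"
    and lam_borel: "lam \<in> borel_measurable borel"
    and kappa_pos: "0 < \<kappa>"
    and lam_periodic: "\<forall>t. lam (t + \<kappa>) = lam t"
    and lamh_pos: "0 < lamh"
    and lam_bounds: "\<forall>t. 0 \<le> lam t \<and> lam t \<le> lamh"
    and rho_lt1: "ennreal lamh * (\<integral>\<^sup>+y. ennreal y \<partial>interval_measure G) < 1"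
    \<comment> \<open>the M_t/G(Psi)/1+H(Psi) queue\<close>
    and arrivals: "poisson_process M lam N"
    and marks_rv: "\<forall>i. S i \<in> borel_measurable M \<and> Y i \<in> borel_measurable M"
    and marks_iid: "prob_space.indep_vars M (\<lambda>_. borel) (\<lambda>i w. (S i w, Y i w)) UNIV"
    and marks_cdf: "\<forall>i s y. measure M {w\<in>space M. S i w \<le> s \<and> Y i w \<le> y} = \<Psi> s y"
    and marks_indep: "prob_space.indep_set M
          (sets (vimage_algebra (space M) (\<lambda>w t. N w t) (Pi\<^sub>M UNIV (\<lambda>_. count_space UNIV))))
          (sets (vimage_algebra (space M) (\<lambda>w i. (S i w, Y i w)) (Pi\<^sub>M UNIV (\<lambda>_. borel))))"
    \<comment> \<open>the M/G/1 queue with rate lamh, initial customer with service S' 0\<close>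
    and arrivals': "poisson_process M' (\<lambda>_. lamh) N'"
    and svc_rv': "\<forall>i. S' i \<in> borel_measurable M'"
    and svc_iid': "prob_space.indep_vars M' (\<lambda>_. borel) S' UNIV"
    and svc_cdf': "\<forall>i s. measure M' {w\<in>space M'. S' i w \<le> s} = G s"
    and svc_indep': "prob_space.indep_set M'
          (sets (vimage_algebra (space M') (\<lambda>w t. N' w t) (Pi\<^sub>M UNIV (\<lambda>_. count_space UNIV))))
          (sets (vimage_algebra (space M') (\<lambda>w i. S' i w) (Pi\<^sub>M UNIV (\<lambda>_. borel))))"
    \<comment> \<open>hypotheses on G and on the busy period phi\<close>
    and subexp: "subexponential G"
    and busy_tail: "((\<lambda>u. measure M' {w\<in>space M'.
            busy_period (workload (N' w) (S' 0 w) (\<lambda>i. S' i w) (\<lambda>_. \<infinity>)) > ereal u}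
          / (1 - G (u * (1 - \<rho>)))) \<longlongrightarrow> 1 / (1 - \<rho>)) at_top"
  shows "Limsup at_top (\<lambda>u. ereal (measure M {w\<in>space M.
            xi_time \<kappa> (workload (N w) 0 (\<lambda>i. S i w) (\<lambda>i. Y i w)) > ereal u}
          / (1 - G ((u - max \<kappa> 1) * (1 - \<rho>)))))
        \<le> ereal ((1 - exp (- \<kappa> * lamh)) / ((1 - \<rho>) * exp (- \<kappa> * lamh)))"
proof -
  define \<mu> where "\<mu> = interval_measure G"
  define \<beta> where "\<beta> = 1 - exp (- \<kappa> * lamh)"
  define c0 where "c0 = 1 / (1 - \<rho>)"
  define \<phi> where "\<phi> w = busy_period (workload (N' w) (S' 0 w) (\<lambda>i. S' i w) (\<lambda>_. \<infinity>))" for w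
  let ?PN = "Pi\<^sub>M UNIV (\<lambda>_. count_space UNIV) :: (real \<Rightarrow> nat) measure"
  interpret M: prob_space M using arrivals by (simp add: poisson_process_def)
  interpret M': prob_space M' using arrivals' by (simp add: poisson_process_def)
  have S_rv [measurable]: "S i \<in> borel_measurable M" for i using marks_rv by auto
  have S'_rv [measurable]: "S' i \<in> borel_measurable M'" for i using svc_rv' by auto

  have S_cdf: "measure (distr M borel (S i)) {..s} = G s" for i s
  proof -
    have "measure (distr M borel (S i)) {..s} = M.prob {w\<in>space M. S i w \<le> s \<and> Y i w \<le> \<infinity>}"
      by (subst measure_distr) (auto simp: vimage_def Int_def conj_commute)
    then show ?thesis using marks_cdf[rule_format, of i s \<infinity>] by (simp only: G_def svc_cdf_def)
  qed
  have S'_cdf: "measure (distr M' borel (S' i)) {..s} = G s" for i s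
  proof -
    have "measure (distr M' borel (S' i)) {..s} = M'.prob {w\<in>space M'. S' i w \<le> s}"
      by (subst measure_distr) (auto simp: vimage_def Int_def conj_commute)
    then show ?thesis using svc_cdf' by simp
  qed
  have S_distr: "distr M borel (S i) = \<mu>" for i
    unfolding \<mu>_def by (rule interval_measure_eqI[symmetric]) (auto simp: S_cdf)
  have S'_distr: "distr M' borel (S' i) = \<mu>" for i
    unfolding \<mu>_def by (rule interval_measure_eqI[symmetric]) (auto simp: S'_cdf)
  interpret mu: real_distribution \<mu>
    using M.real_distribution_distr[of "S 0"] by (simp add: S_distr)
  have mu_Iic: "measure \<mu> {..s} = G s" for s using S_cdf[of 0 s] by (simp add: S_distr)
  have mu_Ioi: "measure \<mu> {s<..} = 1 - G s" for s
    using mu.prob_compl[of "{..s}"] by (simp add: mu_Iic Compl_atMost[symmetric] Compl_eq_Diff_UNIV)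

  have G0: "G 0 = 0"
  proof -
    obtain Q :: "(real \<times> ereal) measure" where Q: "prob_space Q" "sets Q = sets borel"
      "measure Q ({0<..} \<times> {0<..}) = 1" "\<And>s y. \<Psi> s y = measure Q ({..s} \<times> {..y})"
      using L by (auto simp: in_L_def)
    interpret Q: prob_space Q by fact
    have sets: "{0<..} \<times> {0<..} \<in> sets Q" "{..0} \<times> {..\<infinity>} \<in> sets Q"
      unfolding Q(2) by (intro borel_open open_Times open_greaterThan) (intro borel_closed closed_Times closed_atMost)
    have "Q.prob (({0<..} \<times> {0<..}) \<union> ({..0} \<times> {..\<infinity>})) = 1 + Q.prob ({..0} \<times> {..\<infinity>})"
      using sets Q(3) by (subst Q.finite_measure_Union) auto
    then have "Q.prob ({..0} \<times> {..\<infinity>}) \<le> 0" using Q.prob_le_1[of "({0<..} \<times> {0<..}) \<union> ({..0} \<times> {..\<infinity>})"] by simp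
    then have "Q.prob ({..0} \<times> {..\<infinity>}) = 0" by (simp only: measure_le_0_iff)
    then show ?thesis by (simp add: G_def svc_cdf_def Q(4))
  qed
  have mu_pos: "AE s in \<mu>. 0 < s"
  proof -
    have "measure \<mu> {0<..} = 1" by (simp add: mu_Ioi G0)
    then show ?thesis by (subst (asm) mu.prob_eq_1) auto
  qed
  then have mu_nonneg: "AE s in \<mu>. 0 \<le> s" by eventually_elim simp
  have AE_S: "AE w in M. \<forall>i. 0 \<le> S (Suc i) w"
  proof (subst AE_all_countable, intro allI)
    show "AE w in M. 0 \<le> S (Suc i) w" for i
      using mu_nonneg unfolding S_distr[of "Suc i", symmetric] by (subst (asm) AE_distr_iff) auto
  qed
  have AE_S': "AE w in M'. \<forall>i. 0 \<le> S' i w"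
  proof (subst AE_all_countable, intro allI)
    show "AE w in M'. 0 \<le> S' i w" for i
      using mu_nonneg unfolding S'_distr[of i, symmetric] by (subst (asm) AE_distr_iff) auto
  qed

  \<comment> \<open>\<open>\<rho>\<close> is a Bochner integral and the hypothesis a nonnegative
    one; they agree because services are almost surely nonnegative.\<close>
  have \<rho>: "\<rho> < 1"
  proof -
    have "(\<integral>y. y \<partial>\<mu>) = enn2real (\<integral>\<^sup>+y. ennreal y \<partial>\<mu>)"
      by (rule integral_eq_nn_integral) (use mu_nonneg in auto)
    then have "\<rho> = enn2real (ennreal lamh * (\<integral>\<^sup>+y. ennreal y \<partial>\<mu>))"
      using lamh_pos by (simp add: \<rho>_def \<mu>_def enn2real_mult)
    also have "\<dots> < 1"
    proof -
      have "enn2real x < 1" if "x < 1" for x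
        using that by (cases x) (auto simp: ennreal_less_one_iff)
      then show ?thesis using rho_lt1 by (simp add: \<mu>_def)
    qed
    finally show ?thesis .
  qed

  have fst_meas: "(\<lambda>p. fst p) \<in> measurable (borel :: (real \<times> ereal) measure) borel"
    by (intro borel_measurable_continuous_onI continuous_on_fst continuous_on_id)
  have iid: "M.indep_vars (\<lambda>_. borel) (\<lambda>i. S (Suc i)) UNIV"
    using M.indep_vars_Suc[OF M.indep_vars_compose2[OF marks_iid fst_meas]] by simp
  have indep: "M.indep_set (sets (vimage_algebra (space M) (\<lambda>w t. N w t) ?PN))
      (sets (vimage_algebra (space M) (\<lambda>w i. S (Suc i) w) (Pi\<^sub>M UNIV (\<lambda>_. borel))))"
  proof (rule M.indep_set_mono[OF marks_indep order_refl])
    let ?P2 = "Pi\<^sub>M UNIV (\<lambda>_. borel) :: (nat \<Rightarrow> real \<times> ereal) measure"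
    have proj: "(\<lambda>p i. fst (p (Suc i))) \<in> measurable ?P2 (Pi\<^sub>M UNIV (\<lambda>_. borel))"
      by (rule measurable_PiM_single') (auto intro!: measurable_compose[OF _ fst_meas])
    show "sets (vimage_algebra (space M) (\<lambda>w i. S (Suc i) w) (Pi\<^sub>M UNIV (\<lambda>_. borel)))
       \<subseteq> sets (vimage_algebra (space M) (\<lambda>w i. (S i w, Y i w)) ?P2)"
    proof
      fix A assume "A \<in> sets (vimage_algebra (space M) (\<lambda>w i. S (Suc i) w) (Pi\<^sub>M UNIV (\<lambda>_. borel)))"
      then obtain B where B: "B \<in> sets (Pi\<^sub>M UNIV (\<lambda>_. borel))" "A = (\<lambda>w i. S (Suc i) w) -` B \<inter> space M"
        by (subst (asm) sets_vimage_algebra2) (auto simp: space_PiM)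
      have "(\<lambda>p i. fst (p (Suc i))) -` B \<inter> space ?P2 \<in> sets ?P2"
        by (rule measurable_sets[OF proj B(1)])
      from in_vimage_algebra[OF this, of "\<lambda>w i. (S i w, Y i w)" "space M"]
      show "A \<in> sets (vimage_algebra (space M) (\<lambda>w i. (S i w, Y i w)) ?P2)"
        unfolding B(2) by (simp add: space_PiM vimage_def)
    qed
  qed
  \<comment> \<open>Arrivals are numbered from 1, so the chain reads the marks
    \<open>S (Suc i)\<close>; in \<open>model'\<close> mark 0 belongs to the customer who opens the
    busy period.\<close>
  have model: "slotted_model M \<mu> lam lamh (\<kappa> / real K) N (\<lambda>i. S (Suc i)) K" if "0 < K" for K
    by unfold_locales
       (use arrivals lam_borel lam_bounds kappa_pos that lamh_pos mu_nonneg AE_S indep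
          M.distr_iid_sequence[OF iid S_distr] in auto)
  have model': "slotted_model M' \<mu> (\<lambda>_. lamh) lamh (\<kappa> / real K) N' S' K" if "0 < K" for K
    by unfold_locales
       (use arrivals' kappa_pos that lamh_pos mu_nonneg AE_S' svc_indep'
          M'.distr_iid_sequence[OF svc_iid' S'_distr] in auto)

  \<comment> \<open>The law of a service time divided by \<open>1 - \<rho>\<close>: its tail is the
    denominator in the busy-period hypothesis, and subexponentiality survives the scaling.\<close>
  define \<nu> where "\<nu> = distr \<mu> borel (\<lambda>s. s / (1 - \<rho>))"
  interpret nu: real_distribution \<nu> unfolding \<nu>_def by (rule mu.real_distribution_distr) simp
  have Q_eq: "measure \<nu> {v<..} = 1 - G (v * (1 - \<rho>))" for v
  proof -
    have "measure \<nu> {v<..} = measure \<mu> {v * (1 - \<rho>)<..}"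
      unfolding \<nu>_def using \<rho> by (subst measure_distr) (auto simp: vimage_def pos_less_divide_eq greaterThan_def)
    then show ?thesis by (simp add: mu_Ioi)
  qed
  have Q_pos: "0 < measure \<nu> {v<..}" for v
    using subexp by (simp add: Q_eq subexponential_def)
  have nu_nonneg: "AE r in \<nu>. 0 \<le> r"
    unfolding \<nu>_def using mu_nonneg \<rho> by (subst AE_distr_iff) auto
  have G_meas: "G \<in> borel_measurable borel"
  proof (rule borel_measurable_mono, rule monoI)
    show "G x \<le> G y" if "x \<le> y" for x y
      using that mu.finite_measure_mono[of "{..x}" "{..y}"] by (simp add: mu_Iic[symmetric])
  qed
  have conv: "((\<lambda>u. (\<integral>r. measure \<nu> {u - r<..} \<partial>\<nu>) / measure \<nu> {u<..}) \<longlongrightarrow> 2) at_top"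
  proof -
    have eq: "(\<integral>r. measure \<nu> {u - r<..} \<partial>\<nu>) = 1 - (\<integral>y. G (u * (1 - \<rho>) - y) \<partial>\<mu>)" for u
    proof -
      have [measurable]: "G \<in> borel_measurable borel" by (rule G_meas)
      have int: "integrable \<mu> (\<lambda>y. G (u * (1 - \<rho>) - y))"
      proof (rule mu.integrable_const_bound[where B = 1])
        have "0 \<le> G x" "G x \<le> 1" for x by (simp_all add: mu_Iic[symmetric])
        then show "AE y in \<mu>. norm (G (u * (1 - \<rho>) - y)) \<le> 1" by simp
      qed simp
      have "(\<integral>r. measure \<nu> {u - r<..} \<partial>\<nu>) = (\<integral>r. 1 - G ((u - r) * (1 - \<rho>)) \<partial>\<nu>)" by (simp only: Q_eq)
      also have "\<dots> = (\<integral>s. 1 - G ((u - s / (1 - \<rho>)) * (1 - \<rho>)) \<partial>\<mu>)"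
        unfolding \<nu>_def by (rule integral_distr) auto
      also have "\<dots> = (\<integral>s. 1 - G (u * (1 - \<rho>) - s) \<partial>\<mu>)"
        using \<rho> by (simp add: left_diff_distrib)
      also have "\<dots> = 1 - (\<integral>y. G (u * (1 - \<rho>) - y) \<partial>\<mu>)"
        using mu.prob_space by (subst Bochner_Integration.integral_diff[OF _ int]) auto
      finally show ?thesis .
    qed
    have "filterlim (\<lambda>u. u * (1 - \<rho>)) at_top at_top"
      using \<rho> by (intro filterlim_at_top_mult_tendsto_pos[OF tendsto_const] filterlim_ident) simp
    moreover have "((\<lambda>x. (1 - (\<integral>y. G (x - y) \<partial>\<mu>)) / (1 - G x)) \<longlongrightarrow> 2) at_top"
      using subexp by (simp only: subexponential_def \<mu>_def)
    ultimately have "((\<lambda>u. (1 - (\<integral>y. G (u * (1 - \<rho>) - y) \<partial>\<mu>)) / (1 - G (u * (1 - \<rho>)))) \<longlongrightarrow> 2) at_top"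
      by (rule filterlim_compose[rotated])
    then show ?thesis unfolding eq unfolding Q_eq .
  qed

  have c0: "0 < c0" using \<rho> by (simp add: c0_def)
  have tail: "((\<lambda>u. M'.prob {w\<in>space M'. ereal u < \<phi> w} / measure \<nu> {u<..}) \<longlongrightarrow> c0) at_top"
    using busy_tail by (simp add: Q_eq \<phi>_def c0_def)
  \<comment> \<open>A nonmeasurable event has measure \<open>0\<close>, so positivity of the tail gives measurability.\<close>
  have "\<forall>\<^sub>F u in at_top. 0 < M'.prob {w\<in>space M'. ereal u < \<phi> w} / measure \<nu> {u<..}"
    by (rule order_tendstoD(1)[OF tail c0])
  then have "\<forall>\<^sub>F u in at_top. {w\<in>space M'. ereal u < \<phi> w} \<in> M'.events"
    by eventually_elim (metis div_0 less_irrefl measure_notin_sets)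
  then obtain u0' where u0': "\<And>u. u0' \<le> u \<Longrightarrow> {w\<in>space M'. ereal u < \<phi> w} \<in> M'.events"
    by (auto simp: eventually_at_top_linorder)
  define u0 where "u0 = max u0' 0"
  have u0: "0 \<le> u0" "\<And>u. u0 \<le> u \<Longrightarrow> {w\<in>space M'. ereal u < \<phi> w} \<in> M'.events"
    using u0' by (auto simp: u0_def)
  have \<phi>_lim: "((\<lambda>u. M'.prob {w\<in>space M'. ereal u < \<phi> w}) \<longlongrightarrow> 0) at_top"
  proof -
    have "(cdf \<nu> \<longlongrightarrow> 1) at_top" by (rule nu.cdf_lim_at_top_prob)
    moreover have "measure \<nu> {u<..} = 1 - cdf \<nu> u" for u
      using nu.prob_compl[of "{..u}"] by (simp add: cdf_def Compl_atMost[symmetric] Compl_eq_Diff_UNIV)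
    ultimately have "((\<lambda>u. measure \<nu> {u<..}) \<longlongrightarrow> 1 - 1) at_top"
      by (simp only:) (intro tendsto_intros)
    from tendsto_mult[OF tail this] show ?thesis using Q_pos by (simp add: less_imp_neq[THEN not_sym])
  qed
  obtain Z where Z: "Z \<in> borel_measurable M'" "\<And>w. u0 \<le> Z w"
    "\<And>v. u0 \<le> v \<Longrightarrow> M'.prob {w\<in>space M'. v < Z w} = M'.prob {w\<in>space M'. ereal v < \<phi> w}"
    using M'.finite_part_exists[OF u0(2) \<phi>_lim] by blast
  define \<zeta>0 where "\<zeta>0 = distr M' borel Z"
  define \<zeta> where "\<zeta> = distr M' borel (\<lambda>w. Z w + (\<kappa> + 1))"
  note Z(1) [measurable]
  have \<zeta>0_tail: "measure \<zeta>0 {v<..} = M'.prob {w\<in>space M'. v < Z w}" for v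
    unfolding \<zeta>0_def by (subst measure_distr) (auto simp: vimage_def Int_def conj_commute)
  have \<zeta>_tail: "measure \<zeta> {v<..} = measure \<zeta>0 {v - (\<kappa> + 1)<..}" for v
    unfolding \<zeta>0_tail unfolding \<zeta>_def
    by (subst measure_distr) (auto simp: vimage_def Int_def conj_commute diff_less_eq)
  have \<beta>: "0 \<le> \<beta>" "\<beta> < 1" using kappa_pos lamh_pos by (auto simp: \<beta>_def)
  \<comment> \<open>Serves to obtain \<open>tail_ratio_shift\<close>, which carries the constant
    \<open>c0\<close> from the busy period over to \<open>\<zeta>\<close>, its translate by
    \<open>\<kappa> + 1\<close>.\<close>
  interpret E0: subexp_comparison \<nu> \<zeta>0 "\<lambda>v. measure \<nu> {v<..}" "\<lambda>v. measure \<zeta>0 {v<..}" c0 \<beta>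
  proof (intro subexp_comparison.intro subexp_comparison_axioms.intro)
    show "real_distribution \<zeta>0" unfolding \<zeta>0_def by (rule M'.real_distribution_distr) simp
    show "AE z in \<zeta>0. 0 \<le> z" unfolding \<zeta>0_def using Z(2) u0(1)
      by (subst AE_distr_iff) (auto intro: order_trans)
    show "((\<lambda>u. measure \<zeta>0 {u<..} / measure \<nu> {u<..}) \<longlongrightarrow> c0) at_top"
    proof (rule Lim_transform_eventually[OF tail])
      show "\<forall>\<^sub>F u in at_top. M'.prob {w\<in>space M'. ereal u < \<phi> w} / measure \<nu> {u<..} = measure \<zeta>0 {u<..} / measure \<nu> {u<..}"
        using eventually_ge_at_top[of u0] by eventually_elim (simp add: \<zeta>0_tail Z(3))
    qed
  qed (use nu_nonneg Q_pos conv \<beta> nu.real_distribution_axioms in auto)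
  have \<zeta>: "real_distribution \<zeta>" unfolding \<zeta>_def by (rule M'.real_distribution_distr) simp
  have \<zeta>_ge: "AE z in \<zeta>. \<kappa> + 1 \<le> z" unfolding \<zeta>_def using Z(2) u0(1)
    by (subst AE_distr_iff) (auto intro: order_trans)
  interpret E: subexp_comparison \<nu> \<zeta> "\<lambda>v. measure \<nu> {v<..}" "\<lambda>v. measure \<zeta> {v<..}" c0 \<beta>
  proof (intro subexp_comparison.intro subexp_comparison_axioms.intro \<zeta>)
    show "AE z in \<zeta>. 0 \<le> z" using \<zeta>_ge by eventually_elim (use kappa_pos in simp)
    show "((\<lambda>u. measure \<zeta> {u<..} / measure \<nu> {u<..}) \<longlongrightarrow> c0) at_top"
      unfolding \<zeta>_tail using kappa_pos by (intro E0.tail_ratio_shift) simp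
  qed (use nu_nonneg Q_pos conv \<beta> nu.real_distribution_axioms in auto)

  let ?xi = "\<lambda>u. measure M {w\<in>space M. ereal u < xi_time \<kappa> (workload (N w) 0 (\<lambda>i. S i w) (\<lambda>i. Y i w))}"
  have target: "(1 - exp (- \<kappa> * lamh)) / ((1 - \<rho>) * exp (- \<kappa> * lamh)) = \<beta> * c0 / (1 - \<beta>)"
    by (simp add: \<beta>_def c0_def)
  have main: "\<forall>\<^sub>F u in at_top. ?xi u / (1 - G ((u - max \<kappa> 1) * (1 - \<rho>))) \<le> \<beta> * c0 / (1 - \<beta>) + e" if e: "0 < e" for e
  proof -
    \<comment> \<open>Half of \<open>e\<close> is spent on \<open>D\<close>, the other half on the
      shift by \<open>\<kappa> + 1\<close>, whose effect vanishes by
      \<open>long_tailed\<close>.\<close>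
    define l where "l = \<beta> * c0 / (1 - \<beta>) + e / 2"
    have l: "0 < l" using \<beta> c0 e by (auto simp: l_def intro!: add_nonneg_pos divide_nonneg_nonneg)
    obtain D where D: "E.supersolution D" "\<forall>\<^sub>F u in at_top. D u \<le> l * measure \<nu> {u<..}"
      using E.supersolution_sharp[of "e / 2"] e unfolding l_def by auto
    have sup: "antimono D" "\<And>v. 0 \<le> D v" "\<And>v. D v \<le> 1" "\<And>v. v < 0 \<Longrightarrow> D v = 1"
      "\<And>v. 0 \<le> v \<Longrightarrow> \<beta> * (\<integral>z. D (v - z) \<partial>\<zeta>) \<le> D v"
      using D(1) unfolding E.supersolution_def E.profile_def by auto
    have xi_le: "?xi u \<le> D (u - (\<kappa> + 1))" if "\<kappa> \<le> u" for u
    proof (rule xi_tail_le_profile[OF model model' kappa_pos _ _ \<zeta> \<zeta>_ge _ _ _ _ _ _ _ that, where vmin = u0])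
      show "measure \<zeta> {v + (\<kappa> + 1)<..} = 1" if "v < u0" for v
        unfolding \<zeta>_tail \<zeta>0_tail using that Z(2) by (subst M'.prob_eq_1) (auto intro: less_le_trans)
      show "M'.prob {w\<in>space M'. ereal v < busy_period (workload (N' w) (S' 0 w) (\<lambda>i. S' i w) (\<lambda>_. \<infinity>))}
          \<le> measure \<zeta> {v + (\<kappa> + 1)<..}" if "u0 \<le> v" for v
        unfolding \<zeta>_tail \<zeta>0_tail \<phi>_def[symmetric] using Z(3)[OF that] by simp
      show "{w\<in>space M'. ereal v < busy_period (workload (N' w) (S' 0 w) (\<lambda>i. S' i w) (\<lambda>_. \<infinity>))} \<in> M'.events"
        if "u0 \<le> v" for v
        using u0(2)[OF that] by (simp only: \<phi>_def)
    qed (use sup in \<open>auto simp: \<beta>_def\<close>)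
    have lim: "filterlim (\<lambda>u. u - (\<kappa> + 1)) at_top at_top"
    proof -
      have "filterlim (\<lambda>u. - (\<kappa> + 1) + u) at_top at_top"
        by (rule filterlim_tendsto_add_at_top[OF tendsto_const filterlim_ident])
      moreover have "(\<lambda>u. - (\<kappa> + 1) + u) = (\<lambda>u. u - (\<kappa> + 1))" by auto
      ultimately show ?thesis by simp
    qed
    have "((\<lambda>u. l * (measure \<nu> {u - (\<kappa> + 1)<..} / measure \<nu> {u<..})) \<longlongrightarrow> l * 1) at_top"
      using kappa_pos by (intro tendsto_intros E.long_tailed) simp
    then have "\<forall>\<^sub>F u in at_top. l * (measure \<nu> {u - (\<kappa> + 1)<..} / measure \<nu> {u<..}) < \<beta> * c0 / (1 - \<beta>) + e"
      by (rule order_tendstoD) (use e in \<open>simp add: l_def\<close>)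
    with eventually_ge_at_top[of \<kappa>] eventually_compose_filterlim[OF D(2) lim]
    show ?thesis
    proof eventually_elim
      case (elim u)
      \<comment> \<open>The estimate is obtained with the tail at \<open>u\<close> in the
        denominator; the stated denominator is at least as large.\<close>
      have "measure \<nu> {u<..} \<le> measure \<nu> {u - max \<kappa> 1<..}"
        by (rule nu.finite_measure_mono) auto
      then have "?xi u / measure \<nu> {u - max \<kappa> 1<..} \<le> ?xi u / measure \<nu> {u<..}"
        using Q_pos by (intro divide_left_mono mult_pos_pos) auto
      also have "\<dots> \<le> l * measure \<nu> {u - (\<kappa> + 1)<..} / measure \<nu> {u<..}"
        using xi_le[OF elim(1)] elim(2) by (intro divide_right_mono) auto
      also have "\<dots> \<le> \<beta> * c0 / (1 - \<beta>) + e" using elim(3) by simp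
      finally show ?case by (simp only: Q_eq)
    qed
  qed
  show ?thesis unfolding target
  proof (rule ereal_le_epsilon)
    fix e :: ereal assume e: "0 < e"
    show "Limsup at_top (\<lambda>u. ereal (?xi u / (1 - G ((u - max \<kappa> 1) * (1 - \<rho>))))) \<le> ereal (\<beta> * c0 / (1 - \<beta>)) + e"
    proof (cases e)
      case (real r)
      then show ?thesis using e main[of r] by (auto intro!: Limsup_bounded elim: eventually_mono)
    qed (use e in auto)
  qed
qed

end
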